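(* Let $F$ be a field with $|F|>2$. Then: (i) $\mathrm{indep}_{\mathrm{GL}_3(F)}(\mathrm{Sub}(F^3))=5$. In particular, every $\mathrm{GL}_3(F)$-independent subset of $\mathrm{Sub}(F^3)$ has $5$ or fewer elements. (ii) A $5$-element subset $S$ of $\mathrm{Sub}(F^3)$ is $\mathrm{GL}_3(F)$-independent if and only if one of the following holds: (1) $S$ consists of $3$ lines $L_1,L_2,L_3$ and $2$ planes $P_1,P_2$ such that $L_1\subseteq P_1$, $L_2\subseteq P_2$, $L_1+L_2+L_3=F^3$, and $L_i\nsubseteq P_j$ for all $i\in\{1,2,3\}$, $j\in\{1,2\}$ with $i\neq j$; (2) $S$ consists of $3$ planes $P_1,P_2,P_3$ and $2$ lines $L_1,L_2$ such that $L_1\subseteq P_1$, $L_2\subseteq P_2$, $P_1\cap P_2\cap P_3=0$, and $L_i\nsubseteq P_j$ for all $i\in\{1,2\}$, $j\in\{1,2,3\}$ with $i\neq j$.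
   Context: $\mathrm{Sub}(F^n)$ denotes the set of all $F$-subspaces of $F^n$, on which $\mathrm{GL}_n(F)$ acts by $g\cdot V=g(V)$. A subset $S\subseteq \mathrm{Sub}(F^n)$ is called $\mathrm{GL}_n(F)$-independent if for every $V\in S$ there is $a\in \mathrm{GL}_n(F)$ such that $a(U)=U$ for every $U\in S-\{V\}$, but $a(V)\neq V$. The $\mathrm{GL}_n(F)$-independence number $\mathrm{indep}_{\mathrm{GL}_n(F)}(\mathrm{Sub}(F^n))$ is the largest possible size of a $\mathrm{GL}_n(F)$-independent subset of $\mathrm{Sub}(F^n)$. A line (resp. plane) in $F^3$ is a $1$-dimensional (resp. $2$-dimensional) subspace of $F^3$. *)

theory Defs
  imports "HOL-Analysis.Analysis" "HOL-Library.Extended_Nat"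
begin

text \<open>Here \<open>G\<close> is the set of group elements, \<open>act\<close> the action, and \<open>X\<close> the set acted on.\<close>

definition act_indep :: "'g set \<Rightarrow> ('g \<Rightarrow> 'x \<Rightarrow> 'x) \<Rightarrow> 'x set \<Rightarrow> 'x set \<Rightarrow> bool" where
  "act_indep G act X S \<longleftrightarrow>
     S \<subseteq> X \<and> (\<forall>V\<in>S. \<exists>a\<in>G. (\<forall>U\<in>S - {V}. act a U = U) \<and> act a V \<noteq> V)"

definition esize :: "'x set \<Rightarrow> enat" where
  "esize S = (if finite S then enat (card S) else \<infinity>)"

text \<open>The empty set is always independent, and a nonempty set of extended naturals with a finite
  supremum attains it, so whenever this supremum is finite it is a maximum. It is \<open>\<infinity>\<close> if
  the sizes of independent subsets are unbounded.\<close>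

definition indep_number :: "'g set \<Rightarrow> ('g \<Rightarrow> 'x \<Rightarrow> 'x) \<Rightarrow> 'x set \<Rightarrow> enat" where
  "indep_number G act X = Sup {esize S | S. act_indep G act X S}"

definition GL :: "('a::field ^ 'n ^ 'n) set" where
  "GL = {A. invertible A}"

definition Sub :: "('a::field ^ 'n) set set" where
  "Sub = {V. vec.subspace V}"

definition GL_act :: "'a::field ^ 'n ^ 'n \<Rightarrow> ('a ^ 'n) set \<Rightarrow> ('a ^ 'n) set" where
  "GL_act A V = (\<lambda>v. A *v v) ` V"

definition is_line :: "('a::field ^ 3) set \<Rightarrow> bool" where
  "is_line V \<longleftrightarrow> V \<in> Sub \<and> vec.dim V = 1"

definition is_plane :: "('a::field ^ 3) set \<Rightarrow> bool" where
  "is_plane V \<longleftrightarrow> V \<in> Sub \<and> vec.dim V = 2"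

text \<open>The two kinds of configurations. The sum of subspaces is the elementwise sum of sets from
  \<^theory>\<open>HOL-Library.Set_Algebras\<close>. Distinctness of the members is not
  required here; it follows for five-element sets \<open>S\<close>.\<close>

definition lines3_planes2 :: "('a::field ^ 3) set set \<Rightarrow> bool" where
  "lines3_planes2 S \<longleftrightarrow>
     (\<exists>L P :: nat \<Rightarrow> ('a ^ 3) set.
        S = {L 1, L 2, L 3, P 1, P 2} \<and>
        (\<forall>i\<in>{1,2,3}. is_line (L i)) \<and> (\<forall>j\<in>{1,2}. is_plane (P j)) \<and>
        L 1 \<subseteq> P 1 \<and> L 2 \<subseteq> P 2 \<and>
        L 1 + L 2 + L 3 = UNIV \<and>
        (\<forall>i\<in>{1,2,3}. \<forall>j\<in>{1,2}. i \<noteq> j \<longrightarrow> \<not> L i \<subseteq> P j))"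

definition planes3_lines2 :: "('a::field ^ 3) set set \<Rightarrow> bool" where
  "planes3_lines2 S \<longleftrightarrow>
     (\<exists>L P :: nat \<Rightarrow> ('a ^ 3) set.
        S = {P 1, P 2, P 3, L 1, L 2} \<and>
        (\<forall>j\<in>{1,2,3}. is_plane (P j)) \<and> (\<forall>i\<in>{1,2}. is_line (L i)) \<and>
        L 1 \<subseteq> P 1 \<and> L 2 \<subseteq> P 2 \<and>
        P 1 \<inter> P 2 \<inter> P 3 = {0} \<and>
        (\<forall>i\<in>{1,2}. \<forall>j\<in>{1,2,3}. i \<noteq> j \<longrightarrow> \<not> L i \<subseteq> P j))"

end

theory Submission
  imports Defs
begin

text \<open>
  A subspace is redundant as soon as it is a sum or an intersection of other members, and a subfamily
  whose stabilizer consists of scalars must be the whole family. Hence in an independent family with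
  at least five members no three lines are coplanar (three coplanar lines force their plane to be
  fixed linewise) and no four lines are in general position (their stabilizer is scalar), so there
  are at most three lines and, dually, at most three planes. Take three lines \<open>L\<^sub>i\<close> and two planes:
  each plane contains exactly one \<open>L\<^sub>i\<close> (two would make the plane their sum, none would make the
  stabilizer of these four subspaces scalar), and the two planes contain different \<open>L\<^sub>i\<close> (otherwise
  that line is their intersection). The stabilizer of these five is scalar, so nothing else belongs
  to the family. Conversely, in coordinates adapted to such a configuration, explicit matrices built
  from a scalar \<open>c \<noteq> 0, 1\<close> move any one of the five members alone.
\<close>

section \<open>Orthogonal complements and stabilizers\<close>

abbreviation dot :: "'a::field ^ 'n \<Rightarrow> 'a ^ 'n \<Rightarrow> 'a" where
  "dot \<equiv> scalar_product"

lemma dot_commute: "dot v w = dot w v"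
  by (simp add: scalar_product_def mult.commute)

lemma dot_simps [simp]:
  "dot v (x + y) = dot v x + dot v y"
  "dot (x + y) v = dot x v + dot y v"
  "dot v (c *s x) = c * dot v x"
  "dot (c *s x) v = c * dot x v"
  "dot v 0 = 0" "dot 0 v = 0"
  "dot v (x - y) = dot v x - dot v y"
  "dot v (- x) = - dot v x"
  "dot (- x) v = - dot x v"
  by (simp_all add: scalar_product_def algebra_simps sum.distrib sum_distrib_left sum_subtractf
      sum_negf)

lemma dot_axis: "dot v (axis i 1) = v $ i"
  by (simp add: scalar_product_def axis_def if_distrib sum.delta cong: if_cong)

lemma dot_eqI: "(\<And>x. dot v x = dot w x) \<Longrightarrow> v = w"
  by (metis dot_axis vec_eq_iff)

lemma dot_transpose: "dot (transpose A *v v) w = dot v (A *v w)"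
proof -
  have "dot (transpose A *v v) w = (\<Sum>i\<in>UNIV. \<Sum>j\<in>UNIV. A $ j $ i * v $ j * w $ i)"
    by (simp add: scalar_product_def matrix_vector_mult_def transpose_def sum_distrib_right
        del: transpose_matrix_vector)
  also have "\<dots> = (\<Sum>j\<in>UNIV. \<Sum>i\<in>UNIV. A $ j $ i * v $ j * w $ i)"
    by (rule sum.swap)
  also have "\<dots> = dot v (A *v w)"
    by (simp add: scalar_product_def matrix_vector_mult_def sum_distrib_left mult_ac)
  finally show ?thesis .
qed

lemma ex_dot_eq_1:
  assumes "v \<noteq> 0"
  obtains x where "dot v x = 1"
proof -
  obtain y where "dot v y \<noteq> 0"
    using assms dot_eqI[of v 0] by auto
  then have "dot v ((1 / dot v y) *s y) = 1"
    by simp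
  then show ?thesis
    by (rule that)
qed

text \<open>The form is nondegenerate but may be isotropic over a general field, so a subspace can
  meet its \<open>orth\<close>. Complements serve two purposes: they present planes as kernels
  \<open>orth {g}\<close>, and they carry the duality between lines and planes.\<close>

definition orth :: "('a::field ^ 'n) set \<Rightarrow> ('a ^ 'n) set" where
  "orth V = {w. \<forall>v\<in>V. dot v w = 0}"

lemma mem_orth_singleton [simp]: "w \<in> orth {v} \<longleftrightarrow> dot v w = 0"
  by (simp add: orth_def)

lemma subspace_orth: "vec.subspace (orth V)"
  by (auto simp: vec.subspace_def orth_def)

lemma mem_span_singleton: "w \<in> vec.span {v} \<longleftrightarrow> (\<exists>c. w = c *s v)"
  by (auto simp: vec.span_singleton)

lemma span_singleton_eqI:
  assumes "w = c *s v" "c \<noteq> 0"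
  shows "vec.span {w} = vec.span {v}"
proof -
  have "v = (1 / c) *s w"
    using assms by (simp add: vec.scale_scale)
  then have "v \<in> vec.span {w}" "w \<in> vec.span {v}"
    using assms(1) unfolding mem_span_singleton by blast+
  then show ?thesis
    by (intro subset_antisym vec.span_minimal) auto
qed

lemma mem_span_pair: "x \<in> vec.span {v, w} \<longleftrightarrow> (\<exists>a b. x = a *s v + b *s w)"
proof -
  have "x \<in> vec.span {v, w} \<longleftrightarrow> (\<exists>a b. x - a *s v = b *s w)"
    unfolding vec.span_insert[of v "{w}"] mem_span_singleton by simp
  also have "\<dots> \<longleftrightarrow> (\<exists>a b. x = a *s v + b *s w)"
    by (simp only: diff_eq_eq add.commute[of "_ *s w"])
  finally show ?thesis .
qed

lemma span_singleton_neqD: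
  assumes eq: "p *s x + q *s y = 0" and nz: "x \<noteq> 0" "y \<noteq> 0" "vec.span {x} \<noteq> vec.span {y}"
  shows "p = 0 \<and> q = 0"
proof -
  have "x = (- q / p) *s y" if p: "p \<noteq> 0"
  proof -
    have "(1 / p) *s (p *s x + q *s y) = 0"
      unfolding eq by simp
    then have "x + (q / p) *s y = 0"
      using p by (simp only: vec.scale_right_distrib vec.scale_scale) simp
    then show ?thesis
      by (simp add: add_eq_0_iff2)
  qed
  then have "p = 0"
    using nz span_singleton_eqI by (metis vec.scale_zero_left)
  then show ?thesis
    using eq nz by simp
qed

lemma orth_span_singleton: "orth (vec.span {v}) = orth {v}"
proof -
  have "v \<in> vec.span {v}"
    by (simp add: vec.span_base)
  then show ?thesis
    unfolding orth_def by (force simp: mem_span_singleton)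
qed

lemma orth_orth_singleton: "orth (orth {v}) = vec.span {v}"
proof (cases "v = 0")
  case True
  have "w = 0" if "\<forall>x. dot x w = 0" for w :: "'a ^ 'b"
    using that by (metis dot_commute dot_eqI dot_simps(6))
  then show ?thesis
    using True by (auto simp: orth_def)
next
  case False
  then obtain x where x: "dot v x = 1"
    by (rule ex_dot_eq_1)
  show ?thesis
  proof (intro equalityI subsetI)
    fix w assume w: "w \<in> orth (orth {v})"
    \<comment> \<open>Any \<open>y\<close> splits into a multiple of \<open>x\<close> and a vector
      of \<open>orth {v}\<close>, which \<open>w\<close> annihilates; so \<open>w\<close>, as a
      functional, is known from its value at \<open>x\<close>.\<close>
    have "w = dot w x *s v"
    proof (rule dot_eqI)
      fix y
      have "y - dot v y *s x \<in> orth {v}"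
        using x by simp
      then have "dot (y - dot v y *s x) w = 0"
        using w by (simp add: orth_def)
      then show "dot w y = dot (dot w x *s v) y"
        by (simp add: dot_commute[of _ w])
    qed
    then show "w \<in> vec.span {v}"
      by (auto simp: mem_span_singleton)
  qed (auto simp: mem_span_singleton orth_def dot_commute[of _ v])
qed

lemma dim_orth_singleton:
  fixes v :: "'a::field ^ 'n"
  assumes "v \<noteq> 0"
  shows "Suc (vec.dim (orth {v})) = CARD('n)"
proof -
  obtain x where x: "dot v x = 1"
    using assms by (rule ex_dot_eq_1)
  have sp: "vec.span (orth {v}) = orth {v}"
    by (simp add: subspace_orth)
  \<comment> \<open>The kernel of a nonzero functional has codimension one: a single vector
    \<open>x\<close> off it completes it to the whole space.\<close>
  have "y - dot v y *s x \<in> vec.span (orth {v})" for y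
    using x by (simp add: sp)
  then have "vec.span (insert x (orth {v})) = UNIV"
    by (auto simp: vec.span_insert)
  then have "vec.dim (insert x (orth {v})) = CARD('n)"
    by (metis vec.dim_span vec_dim_card)
  then show ?thesis
    using x by (simp add: vec.dim_insert sp)
qed

text \<open>Moving \<open>A\<close> across the form replaces it by its transpose, so
  \<open>w\<close> is orthogonal to the image of \<open>V\<close> exactly when
  \<open>transpose A *v w\<close> is orthogonal to \<open>V\<close>. Complements thus carry the
  contragredient action, by the inverse transpose.\<close>

lemma orth_GL_act:
  fixes A B :: "'a::field ^ 'n ^ 'n"
  assumes "A ** B = mat 1" "B ** A = mat 1"
  shows "orth (GL_act A V) = GL_act (transpose B) (orth V)"
proof -
  have AB: "transpose B *v (transpose A *v w) = w" for w
    using assms(1) by (metis matrix_transpose_mul matrix_vector_mul_assoc matrix_vector_mul_lid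
        transpose_mat)
  have BA: "transpose A *v (transpose B *v w) = w" for w
    using assms(2) by (metis matrix_transpose_mul matrix_vector_mul_assoc matrix_vector_mul_lid
        transpose_mat)
  have iff: "w \<in> orth (GL_act A V) \<longleftrightarrow> transpose A *v w \<in> orth V" for w
    using dot_transpose[of A w]
    by (auto simp: orth_def GL_act_def dot_commute[of _ w]
        dot_commute[of _ "transpose A *v w"] simp del: transpose_matrix_vector)
  show ?thesis
    unfolding set_eq_iff iff
    by (force simp: GL_act_def AB BA image_iff simp del: transpose_matrix_vector)
qed

section \<open>Stabilizers of lines and hyperplanes\<close>

lemma GL_act_subspaceI:
  assumes "vec.subspace V" "invertible A" "\<And>x. x \<in> V \<Longrightarrow> A *v x \<in> V"
  shows "GL_act A V = V"
proof -
  have inj: "inj ((*v) A)"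
    using assms(2) by (simp add: invertible_left_inverse matrix_left_invertible_injective)
  \<comment> \<open>Injectivity keeps the dimension, so mapping \<open>V\<close> into itself already
    means mapping it onto itself.\<close>
  have "vec.dim ((*v) A ` V) = vec.dim V"
    by (rule vec.dim_image_eq) (use inj in \<open>auto intro: inj_on_subset\<close>)
  then show ?thesis
    unfolding GL_act_def using assms
    by (intro vec.subspace_dim_equal) (auto intro: vec.subspace_image)
qed

lemma stab_span_iff:
  assumes "invertible A"
  shows "GL_act A (vec.span {v}) = vec.span {v} \<longleftrightarrow> (\<exists>c. A *v v = c *s v)"
proof
  assume "GL_act A (vec.span {v}) = vec.span {v}"
  then have "A *v v \<in> vec.span {v}"
    unfolding GL_act_def by (metis imageI insertI1 vec.span_base)
  then show "\<exists>c. A *v v = c *s v"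
    by (simp add: mem_span_singleton)
next
  assume "\<exists>c. A *v v = c *s v"
  then show "GL_act A (vec.span {v}) = vec.span {v}"
    using assms by (intro GL_act_subspaceI) (auto simp: mem_span_singleton vec.scale)
qed

text \<open>A hyperplane determines its functional up to a scalar, so a nonzero \<open>g\<close>
  must be an eigenvector of the transpose of \<open>A\<close>; the eigenvalue is read off at a
  vector \<open>x0\<close> where \<open>g\<close> takes the value 1.\<close>

lemma stab_orth_iff:
  assumes "invertible A"
  shows "GL_act A (orth {g}) = orth {g} \<longleftrightarrow> (\<exists>k. \<forall>x. dot g (A *v x) = k * dot g x)"
proof
  assume st: "GL_act A (orth {g}) = orth {g}"
  show "\<exists>k. \<forall>x. dot g (A *v x) = k * dot g x"
  proof (cases "g = 0")
    case False
    then obtain x0 where x0: "dot g x0 = 1"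
      by (rule ex_dot_eq_1)
    have "dot g (A *v x) = dot g (A *v x0) * dot g x" for x
    proof -
      have "x - dot g x *s x0 \<in> orth {g}"
        using x0 by simp
      then have "A *v (x - dot g x *s x0) \<in> orth {g}"
        using st unfolding GL_act_def by blast
      then show ?thesis
        by (simp add: vec.diff vec.scale mult.commute)
    qed
    then show ?thesis
      by blast
  qed simp
next
  assume "\<exists>k. \<forall>x. dot g (A *v x) = k * dot g x"
  then show "GL_act A (orth {g}) = orth {g}"
    using assms by (intro GL_act_subspaceI subspace_orth) auto
qed

lemma GL_act_scalar:
  fixes A :: "'a::field ^ 'n ^ 'n"
  assumes "invertible A" "\<And>x. A *v x = c *s x" "vec.subspace V"
  shows "GL_act A V = V"
  using assms by (intro GL_act_subspaceI) (auto simp: vec.subspace_scale)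

section \<open>Lines and planes of three-space\<close>

lemma dot_3: "dot v w = v $ 1 * w $ 1 + v $ 2 * w $ 2 + v $ (3::3) * w $ 3"
  by (simp add: scalar_product_def sum_3)

lemma is_line_iff: "is_line V \<longleftrightarrow> (\<exists>v. v \<noteq> 0 \<and> V = vec.span {v})"
proof
  assume V: "is_line V"
  obtain B where B: "B \<subseteq> V" "vec.independent B" "V \<subseteq> vec.span B" "card B = vec.dim V"
    by (rule vec.basis_exists)
  then obtain v where v: "B = {v}"
    using V by (metis One_nat_def card_1_singletonE is_line_def)
  have "V = vec.span {v}"
    using B V v vec.span_minimal[of B V] by (auto simp: is_line_def Sub_def)
  moreover have "v \<noteq> 0"
    using B v vec.dependent_zero by auto
  ultimately show "\<exists>v. v \<noteq> 0 \<and> V = vec.span {v}"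
    by blast
qed (auto simp: is_line_def Sub_def)

text \<open>Coefficients are used instead of independence of the set \<open>{u, v, w}\<close>,
  because a set would forget repeated vectors.\<close>

definition indep3 :: "'a::field ^ 3 \<Rightarrow> 'a ^ 3 \<Rightarrow> 'a ^ 3 \<Rightarrow> bool" where
  "indep3 u v w \<longleftrightarrow> (\<forall>a b c. a *s u + b *s v + c *s w = 0 \<longrightarrow> a = 0 \<and> b = 0 \<and> c = 0)"

section \<open>Independence of three vectors through 3 by 3 matrices\<close>

lemma columns3_mult:
  "transpose (vector [u, v, w] :: 'a::field ^ 3 ^ 3) *v x = x $ 1 *s u + x $ 2 *s v + x $ 3 *s w"
  by (simp add: vec_eq_iff matrix_vector_mult_def transpose_def sum_3 mult_ac
      del: transpose_matrix_vector)

lemma rows3_mult: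
  "(vector [u, v, w] :: 'a::field ^ 3 ^ 3) *v x = vector [dot u x, dot v x, dot w x]"
  by (simp add: vec_eq_iff matrix_vector_mult_def forall_3 dot_3 sum_3)

lemma indep3_iff_columns:
  "indep3 u v w \<longleftrightarrow> invertible (transpose (vector [u, v, w] :: 'a::field ^ 3 ^ 3))"
proof -
  have "indep3 u v w \<longleftrightarrow>
    (\<forall>x. transpose (vector [u, v, w] :: 'a ^ 3 ^ 3) *v x = 0 \<longrightarrow> x = 0)"
    unfolding columns3_mult forall_vector_3 indep3_def
    by (simp add: vec_eq_iff[of _ "0 :: 'a ^ 3"] forall_3)
  then show ?thesis
    unfolding invertible_left_inverse matrix_left_invertible_ker .
qed

text \<open>A square matrix and its transpose have the same determinant, so the criterion by columns
  becomes one by rows, and the kernel of the row matrix consists of the vectors orthogonal to all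
  three.\<close>

lemma indep3_iff_orth:
  "indep3 u v w \<longleftrightarrow> (\<forall>x. dot u x = 0 \<and> dot v x = 0 \<and> dot w x = 0 \<longrightarrow> x = 0)"
proof -
  have "indep3 u v w \<longleftrightarrow> invertible (vector [u, v, w] :: 'a ^ 3 ^ 3)"
    by (simp add: indep3_iff_columns invertible_det_nz)
  also have "\<dots> \<longleftrightarrow> (\<forall>x. (vector [u, v, w] :: 'a ^ 3 ^ 3) *v x = 0 \<longrightarrow> x = 0)"
    unfolding invertible_left_inverse matrix_left_invertible_ker ..
  finally show ?thesis
    by (simp add: rows3_mult vec_eq_iff[of "vector _"] forall_3)
qed

lemma indep3_iff_expand:
  "indep3 u v w \<longleftrightarrow> (\<forall>x. \<exists>a b c. x = a *s u + b *s v + c *s w)"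
proof -
  have "indep3 u v w \<longleftrightarrow> surj ((*v) (transpose (vector [u, v, w] :: 'a::field ^ 3 ^ 3)))"
    unfolding indep3_iff_columns invertible_right_inverse matrix_right_invertible_surjective ..
  also have "\<dots> \<longleftrightarrow> (\<forall>x. \<exists>y::'a ^ 3. x = y $ 1 *s u + y $ 2 *s v + y $ 3 *s w)"
    unfolding surj_def columns3_mult ..
  also have "\<dots> \<longleftrightarrow> (\<forall>x. \<exists>a b c. x = a *s u + b *s v + c *s w)"
    by (metis vector_3)
  finally show ?thesis .
qed

lemma indep3_iff_span_sum:
  "indep3 u v w \<longleftrightarrow> vec.span {u} + vec.span {v} + vec.span {w} = UNIV"
proof -
  have "x \<in> vec.span {u} + vec.span {v} + vec.span {w} \<longleftrightarrow> (\<exists>a b c. x = a *s u + b *s v + c *s w)" for x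
    unfolding set_plus_def vec.span_singleton by (simp add: bex_simps) metis
  then show ?thesis
    unfolding indep3_iff_expand by blast
qed

lemma ex_dot2_eq_0: "\<exists>g. g \<noteq> 0 \<and> dot g u = 0 \<and> dot g v = 0" for u v :: "'a::field ^ 3"
proof -
  \<comment> \<open>A triple containing the zero vector is dependent, so by the row criterion some
    nonzero vector is orthogonal to all three.\<close>
  have "\<not> indep3 u v 0"
    unfolding indep3_def by (metis add_0 vec.scale_zero_left vec.scale_zero_right zero_neq_one)
  then show ?thesis
    by (auto simp: indep3_iff_orth dot_commute)
qed

lemma is_plane_iff: "is_plane V \<longleftrightarrow> (\<exists>g. g \<noteq> 0 \<and> V = orth {g})"
proof
  assume V: "is_plane V"
  obtain B where B: "B \<subseteq> V" "vec.independent B" "V \<subseteq> vec.span B" "card B = vec.dim V"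
    by (rule vec.basis_exists)
  then obtain u v where uv: "B = {u, v}"
    using V by (metis card_2_iff is_plane_def)
  obtain g where g: "g \<noteq> 0" "dot g u = 0" "dot g v = 0"
    using ex_dot2_eq_0 by blast
  \<comment> \<open>\<open>g\<close> annihilates a basis of \<open>V\<close>, and
    \<open>orth {g}\<close> has dimension two as well, so the inclusion is an equality.\<close>
  have "vec.span B \<subseteq> orth {g}"
    using g uv by (intro vec.span_minimal subspace_orth) auto
  then have "V = orth {g}"
    using V B dim_orth_singleton[of g] g
    by (intro vec.subspace_dim_equal) (auto simp: is_plane_def Sub_def subspace_orth)
  then show "\<exists>g. g \<noteq> 0 \<and> V = orth {g}"
    using g by blast
next
  assume "\<exists>g. g \<noteq> 0 \<and> V = orth {g}"
  then show "is_plane V"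
    using dim_orth_singleton by (fastforce simp: is_plane_def Sub_def subspace_orth)
qed

lemma subspace_is_line_or_plane:
  assumes "V \<in> Sub" "V \<noteq> {0}" "V \<noteq> (UNIV :: ('a::field ^ 3) set)"
  shows "is_line V \<or> is_plane V"
proof -
  have sp: "vec.span V = V" "0 \<in> V"
    using assms(1) by (auto simp: Sub_def vec.subspace_0)
  have "vec.dim V \<noteq> 0"
    using assms(2) sp by auto
  moreover have "vec.dim V \<noteq> 3"
    using assms(3) vec.dim_eq_full[of V] unfolding sp(1)
    by (simp add: vec.dimension_def card_cart_basis)
  moreover have "vec.dim V \<le> 3"
    using dim_subset_UNIV_cart_gen[of V] by simp
  ultimately have "vec.dim V = 1 \<or> vec.dim V = 2"
    by linarith
  then show ?thesis
    using assms(1) by (auto simp: is_line_def is_plane_def)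
qed

lemma span_pair_eq_orth:
  fixes v w g :: "'a::field ^ 3"
  assumes "v \<noteq> 0" "w \<noteq> 0" "vec.span {v} \<noteq> vec.span {w}"
    and "g \<noteq> 0" "dot g v = 0" "dot g w = 0"
  shows "vec.span {v, w} = orth {g}"
proof -
  have "v \<notin> vec.span {w}"
    using assms(1,3) by (metis mem_span_singleton span_singleton_eqI vec.scale_zero_left)
  then have "vec.dim (vec.span {v, w}) = 2"
    using assms(2) by (simp add: vec.dim_insert)
  then show ?thesis
    using assms dim_orth_singleton[of g]
    by (intro vec.subspace_dim_equal vec.span_minimal subspace_orth) auto
qed

section \<open>Dependencies between stabilizers\<close>

text \<open>A closure relation from the Galois connection between families and their stabilizers.
  Independence says that no member lies in the closure of the others, so configurations are excluded
  by exhibiting a dependency.\<close>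

definition determines :: "('a::field ^ 'n) set set \<Rightarrow> ('a ^ 'n) set \<Rightarrow> bool" where
  "determines T V \<longleftrightarrow>
     (\<forall>A. invertible A \<longrightarrow> (\<forall>U\<in>T. GL_act A U = U) \<longrightarrow> GL_act A V = V)"

abbreviation GL_indep :: "('a::field ^ 'n) set set \<Rightarrow> bool" where
  "GL_indep S \<equiv> act_indep GL GL_act Sub S"

lemma GL_indep_not_determines:
  assumes "GL_indep S" "V \<in> S" "T \<subseteq> S" "V \<notin> T"
  shows "\<not> determines T V"
proof -
  obtain a where a: "invertible a" "\<forall>U\<in>S - {V}. GL_act a U = U" "GL_act a V \<noteq> V"
    using assms(1,2) unfolding act_indep_def GL_def by blast
  have "GL_act a U = U" if "U \<in> T" for U
    using that a(2) assms(3,4) by blast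
  then show ?thesis
    using a(1,3) unfolding determines_def by blast
qed

lemma GL_indep_Sub: "GL_indep S \<Longrightarrow> V \<in> S \<Longrightarrow> vec.subspace V"
  by (auto simp: act_indep_def Sub_def)

lemma act_indep_subset:
  assumes "act_indep G act X S" "T \<subseteq> S"
  shows "act_indep G act X T"
  unfolding act_indep_def
proof (intro conjI ballI)
  fix V assume "V \<in> T"
  then obtain a where a: "a \<in> G" "\<forall>U\<in>S - {V}. act a U = U" "act a V \<noteq> V"
    using assms unfolding act_indep_def by blast
  then have "\<forall>U\<in>T - {V}. act a U = U"
    using assms(2) by blast
  then show "\<exists>a\<in>G. (\<forall>U\<in>T - {V}. act a U = U) \<and> act a V \<noteq> V"
    using a by blast
qed (use assms in \<open>auto simp: act_indep_def\<close>)

text \<open>Scalar matrices fix every subspace, so a member outside \<open>T\<close> would be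
  determined by \<open>T\<close>.\<close>

lemma GL_indep_scalar:
  fixes S T :: "('a::field ^ 'n) set set"
  assumes S: "GL_indep S" "T \<subseteq> S"
    and scalar: "\<And>A. invertible (A :: 'a ^ 'n ^ 'n) \<Longrightarrow> \<forall>U\<in>T. GL_act A U = U \<Longrightarrow>
        \<exists>c. \<forall>x. A *v x = c *s x"
  shows "S = T"
proof (rule ccontr)
  assume "S \<noteq> T"
  then obtain V where V: "V \<in> S" "V \<notin> T"
    using S(2) by blast
  have "determines T V"
    unfolding determines_def using scalar GL_act_scalar[OF _ _ GL_indep_Sub[OF S(1) V(1)]]
    by blast
  then show False
    using GL_indep_not_determines S V by blast
qed

lemma GL_indep_is_line_or_plane:
  fixes V :: "('a::field ^ 3) set"
  assumes "GL_indep S" "V \<in> S"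
  shows "is_line V \<or> is_plane V"
proof -
  have nd: "\<not> determines {} V"
    using assms by (intro GL_indep_not_determines) auto
  \<comment> \<open>Both trivial subspaces are fixed by all of \<open>GL\<close>, hence lie in the
    closure of the empty family.\<close>
  have "determines {} {0 :: 'a ^ 3}"
    by (simp add: determines_def GL_act_def)
  moreover have "determines {} (UNIV :: ('a ^ 3) set)"
    unfolding determines_def by (intro allI impI GL_act_subspaceI vec.subspace_UNIV) simp_all
  ultimately have "V \<noteq> {0}" "V \<noteq> UNIV"
    using nd by auto
  then show ?thesis
    using assms by (intro subspace_is_line_or_plane) (auto simp: act_indep_def)
qed

text \<open>A matrix fixing two distinct lines fixes the plane they span, and that plane is
  \<open>orth {g}\<close>.\<close>

lemma determines_join:
  fixes v w g :: "'a::field ^ 3"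
  assumes "v \<noteq> 0" "w \<noteq> 0" "vec.span {v} \<noteq> vec.span {w}"
    and "g \<noteq> 0" "dot g v = 0" "dot g w = 0"
  shows "determines {vec.span {v}, vec.span {w}} (orth {g})"
  unfolding determines_def
proof (intro allI impI)
  fix A :: "'a ^ 3 ^ 3"
  assume A: "invertible A" "\<forall>U\<in>{vec.span {v}, vec.span {w}}. GL_act A U = U"
  then have "\<exists>c. A *v v = c *s v" "\<exists>d. A *v w = d *s w"
    by (simp_all add: stab_span_iff)
  then obtain c d where cd: "A *v v = c *s v" "A *v w = d *s w"
    by auto
  have "A *v x \<in> orth {g}" if x: "x \<in> orth {g}" for x
  proof -
    have "x \<in> vec.span {v, w}"
      using x span_pair_eq_orth[OF assms] by simp
    then obtain a b where "x = a *s v + b *s w"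
      by (auto simp: mem_span_pair)
    then show ?thesis
      using cd assms by (simp add: vec.add vec.scale)
  qed
  then show "GL_act A (orth {g}) = orth {g}"
    using A(1) by (intro GL_act_subspaceI subspace_orth)
qed

lemma GL_act_Int:
  assumes "invertible (A :: 'a::field ^ 'n ^ 'n)"
  shows "GL_act A (U \<inter> V) = GL_act A U \<inter> GL_act A V"
proof -
  have "inj ((*v) A)"
    using assms by (simp add: invertible_left_inverse matrix_left_invertible_injective)
  then show ?thesis
    by (simp add: GL_act_def image_Int)
qed

lemma determines_meet:
  fixes v g h :: "'a::field ^ 3"
  assumes "g \<noteq> 0" "h \<noteq> 0" "orth {g} \<noteq> orth {h}" "v \<noteq> 0" "dot g v = 0" "dot h v = 0"
  shows "determines {orth {g}, orth {h}} (vec.span {v})"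
proof -
  have "vec.span {v} = orth {g} \<inter> orth {h}"
  proof
    show "vec.span {v} \<subseteq> orth {g} \<inter> orth {h}"
      using assms by (auto simp: mem_span_singleton)
    have ne: "vec.span {g} \<noteq> vec.span {h}"
      using assms(3) by (metis orth_span_singleton)
    \<comment> \<open>The span lemma is used with vectors and functionals exchanged: anything
      annihilated by \<open>g\<close> and \<open>h\<close> lies in \<open>orth (orth {v})\<close>,
      which is the line of \<open>v\<close>.\<close>
    have "vec.span {g, h} = orth {v}"
      using assms ne by (intro span_pair_eq_orth) (auto simp: dot_commute)
    then have "orth {v} = {a *s g + b *s h | a b. True}"
      by (auto simp: mem_span_pair set_eq_iff)
    then have "x \<in> orth (orth {v})" if "x \<in> orth {g} \<inter> orth {h}" for x
      using that by (auto simp: orth_def)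
    then show "orth {g} \<inter> orth {h} \<subseteq> vec.span {v}"
      by (auto simp: orth_orth_singleton)
  qed
  then show ?thesis
    by (simp add: determines_def GL_act_Int)
qed

text \<open>Writing \<open>w = - u - v\<close> and comparing coefficients of \<open>A *v w\<close>
  along the independent vectors \<open>u\<close>, \<open>v\<close> leaves a single eigenvalue. Thus
  a matrix fixing three distinct coplanar lines is scalar on their plane.\<close>

lemma eigenvalues_collinear:
  fixes u v w :: "'a::field ^ 'n"
  assumes "u + v + w = 0" "u \<noteq> 0" "v \<noteq> 0" "vec.span {u} \<noteq> vec.span {v}"
    and "A *v u = a *s u" "A *v v = b *s v" "A *v w = c *s w"
  shows "a = c \<and> b = c"
proof -
  have w: "w = - u - v"
    using assms(1) by (metis add.commute minus_add_distrib minus_unique diff_conv_add_uminus)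
  have "A *v w = - (a *s u) - b *s v"
    using assms by (simp add: w vec.diff vec.neg)
  then have eq: "- (a *s u) - b *s v = - (c *s u) - c *s v"
    using assms(7) by (simp add: w vec.scale_right_diff_distrib)
  have "(a - c) *s u + (b - c) *s v = (- (c *s u) - c *s v) - (- (a *s u) - b *s v)"
    by (simp add: vec.scale_left_diff_distrib)
  then have "(a - c) *s u + (b - c) *s v = 0"
    unfolding eq by simp
  then show ?thesis
    using span_singleton_neqD[of "a - c" u "b - c" v] assms(2-4) by simp
qed

text \<open>Since the lines are pairwise distinct, no coefficient of a nontrivial relation vanishes,
  and the coefficients can be absorbed into the generators.\<close>

lemma dependent_triple_rescale:
  fixes u v w :: "'a::field ^ 3"
  assumes "\<not> indep3 u v w" "u \<noteq> 0" "v \<noteq> 0" "w \<noteq> 0"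
    and "vec.span {u} \<noteq> vec.span {v}" "vec.span {u} \<noteq> vec.span {w}" "vec.span {v} \<noteq> vec.span {w}"
  obtains u' v' w' where "vec.span {u'} = vec.span {u}" "vec.span {v'} = vec.span {v}"
    "vec.span {w'} = vec.span {w}" "u' + v' + w' = 0" "u' \<noteq> 0" "v' \<noteq> 0" "w' \<noteq> 0"
proof -
  obtain a b c where abc: "a *s u + b *s v + c *s w = 0" "a \<noteq> 0 \<or> b \<noteq> 0 \<or> c \<noteq> 0"
    using assms(1) by (auto simp: indep3_def)
  have "a \<noteq> 0"
  proof
    assume "a = 0"
    then show False
      using span_singleton_neqD[of b v c w] abc assms by simp
  qed
  moreover have "b \<noteq> 0"
  proof
    assume "b = 0"
    then show False
      using span_singleton_neqD[of a u c w] abc assms by simp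
  qed
  moreover have "c \<noteq> 0"
  proof
    assume "c = 0"
    then show False
      using span_singleton_neqD[of a u b v] abc assms by simp
  qed
  ultimately show ?thesis
    using abc(1) assms(2-4)
    by (intro that[of "a *s u" "b *s v" "c *s w"] span_singleton_eqI[OF refl]) simp_all
qed

section \<open>Independent families with at least five members\<close>

lemma determines_member: "V \<in> T \<Longrightarrow> determines T V"
  by (simp add: determines_def)

lemma determines_trans:
  "determines T V \<Longrightarrow> (\<And>U. U \<in> T \<Longrightarrow> determines T' U) \<Longrightarrow> determines T' V"
  by (simp add: determines_def)

lemma determines_mono: "determines T V \<Longrightarrow> T \<subseteq> T' \<Longrightarrow> determines T' V"
  by (erule determines_trans) (auto intro: determines_member)

text \<open>As \<open>g\<close> vanishes at neither \<open>v\<close> nor \<open>w\<close>, both have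
  the eigenvalue by which \<open>A\<close> scales the functional \<open>g\<close>; their combination
  \<open>u = - v - w\<close> is then an eigenvector too.\<close>

lemma determines_third:
  fixes u v w g :: "'a::field ^ 'n"
  assumes "u + v + w = 0" "dot g v \<noteq> 0" "dot g w \<noteq> 0"
  shows "determines {vec.span {v}, vec.span {w}, orth {g}} (vec.span {u})"
  unfolding determines_def
proof (intro allI impI)
  fix A :: "'a ^ 'n ^ 'n"
  assume A: "invertible A" "\<forall>U\<in>{vec.span {v}, vec.span {w}, orth {g}}. GL_act A U = U"
  then have "\<exists>b. A *v v = b *s v" "\<exists>c. A *v w = c *s w" "\<exists>k. \<forall>x. dot g (A *v x) = k * dot g x"
    by (simp_all add: stab_span_iff stab_orth_iff)
  then obtain b c k where bck: "A *v v = b *s v" "A *v w = c *s w" "\<And>x. dot g (A *v x) = k * dot g x"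
    by auto
  have "b = k" "c = k"
    using bck(3)[of v] bck(3)[of w] assms(2,3) by (simp_all add: bck(1,2))
  moreover have "u = - v - w"
    using assms(1) by (metis add.assoc add_eq_0_iff2 minus_add_distrib diff_conv_add_uminus)
  ultimately have "A *v u = k *s u"
    by (simp add: bck(1,2) vec.diff vec.neg vec.scale_right_diff_distrib)
  then show "GL_act A (vec.span {u}) = vec.span {u}"
    using A(1) by (auto simp: stab_span_iff)
qed

lemma line_not_plane: "is_line V \<Longrightarrow> \<not> is_plane V"
  by (simp add: is_line_def is_plane_def)

lemma span_neq_orth: "v \<noteq> 0 \<Longrightarrow> g \<noteq> 0 \<Longrightarrow> vec.span {v} \<noteq> orth {g}" for v g :: "'a::field ^ 3"
  by (metis is_line_iff is_plane_iff line_not_plane)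

text \<open>If \<open>g\<close> were nonzero on two of the generators, the third line would be
  determined by those two lines and \<open>T\<close>. So \<open>g\<close> vanishes on at least two
  of them, and on the last by \<open>u + v + w = 0\<close>. \<open>T\<close> is left general because
  \<open>orth {g}\<close> may be a member or merely the join of two member lines.\<close>

lemma GL_indep_collinear:
  fixes u v w g :: "'a::field ^ 3"
  assumes S: "GL_indep S" "{vec.span {u}, vec.span {v}, vec.span {w}} \<subseteq> S"
    and ne: "vec.span {u} \<noteq> vec.span {v}" "vec.span {u} \<noteq> vec.span {w}" "vec.span {v} \<noteq> vec.span {w}"
    and sum: "u + v + w = 0"
    and T: "T \<subseteq> S - {vec.span {u}, vec.span {v}, vec.span {w}}" "determines T (orth {g})"
  shows "dot g u = 0 \<and> dot g v = 0 \<and> dot g w = 0"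
proof -
  have *: "dot g y = 0 \<or> dot g z = 0"
    if "{vec.span {x}, vec.span {y}, vec.span {z}} = {vec.span {u}, vec.span {v}, vec.span {w}}"
      "vec.span {x} \<noteq> vec.span {y}" "vec.span {x} \<noteq> vec.span {z}" "x + y + z = 0" for x y z
  proof (rule ccontr)
    assume "\<not> ?thesis"
    then have "determines {vec.span {y}, vec.span {z}, orth {g}} (vec.span {x})"
      using that by (intro determines_third) auto
    then have det: "determines (insert (vec.span {y}) (insert (vec.span {z}) T)) (vec.span {x})"
      by (rule determines_trans) (auto intro: determines_member determines_mono[OF T(2)])
    have mem: "vec.span {x} \<in> S" "insert (vec.span {y}) (insert (vec.span {z}) T) \<subseteq> S"
      "vec.span {x} \<notin> insert (vec.span {y}) (insert (vec.span {z}) T)"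
      using S(2) T(1) that(2,3) unfolding that(1)[symmetric] by auto
    show False
      using GL_indep_not_determines[OF S(1) mem] det by simp
  qed
  have "dot g v = 0 \<or> dot g w = 0"
    using ne sum by (intro *[of u]) auto
  moreover have "dot g u = 0 \<or> dot g w = 0"
    using ne sum by (intro *[of v]) (auto simp: add_ac)
  moreover have "dot g u = 0 \<or> dot g v = 0"
    using ne sum by (intro *[of w]) (auto simp: add_ac)
  moreover have "dot g u + dot g v + dot g w = 0"
    using arg_cong[OF sum, of "dot g"] by simp
  ultimately show ?thesis
    by auto
qed

lemma ex_two_more:
  assumes "finite S" "card S \<ge> 5" "card T \<le> 3" "finite T"
  obtains X Y where "X \<in> S - T" "Y \<in> S - T" "X \<noteq> Y"
proof -
  have "card S - card T \<le> card (S - T)"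
    using assms(4) by (rule diff_card_le_card_Diff)
  then have "\<not> card (S - T) \<le> Suc 0"
    using assms by linarith
  then show ?thesis
    using that assms(1) card_le_Suc0_iff_eq[of "S - T"] by blast
qed

text \<open>A plane in the family would contain all three coplanar lines and so be the join of two
  of them; hence two further members \<open>X\<close>, \<open>Y\<close> are lines. Their join
  contains the three lines, so \<open>X\<close> lies in the common plane, on which the stabilizer of
  the three lines is scalar.\<close>

lemma GL_indep_lines_indep3:
  fixes u v w :: "'a::field ^ 3"
  assumes S: "GL_indep S" "finite S" "card S \<ge> 5" "{vec.span {u}, vec.span {v}, vec.span {w}} \<subseteq> S"
    and nz: "u \<noteq> 0" "v \<noteq> 0" "w \<noteq> 0"
    and ne: "vec.span {u} \<noteq> vec.span {v}" "vec.span {u} \<noteq> vec.span {w}" "vec.span {v} \<noteq> vec.span {w}"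
  shows "indep3 u v w"
proof (rule ccontr)
  assume "\<not> indep3 u v w"
  then obtain u' v' w' where eqs: "vec.span {u'} = vec.span {u}" "vec.span {v'} = vec.span {v}"
    "vec.span {w'} = vec.span {w}" and sum: "u' + v' + w' = 0"
    and nz': "u' \<noteq> 0" "v' \<noteq> 0" "w' \<noteq> 0"
    using nz ne by (rule dependent_triple_rescale)
  let ?T = "{vec.span {u'}, vec.span {v'}, vec.span {w'}}"
  note S' = S(4)[folded eqs] and ne' = ne[folded eqs]
  note collinear = GL_indep_collinear[OF S(1) S' ne' sum]
  have noplane: "\<not> is_plane X" if "X \<in> S" for X
  proof
    assume "is_plane X"
    then obtain g where g: "g \<noteq> 0" "X = orth {g}"
      by (auto simp: is_plane_iff)
    have X: "X \<notin> ?T"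
      using span_neq_orth g nz' by auto
    have "dot g u' = 0 \<and> dot g v' = 0 \<and> dot g w' = 0"
      using X that g by (intro collinear[of "{X}"]) (auto intro: determines_member)
    then have "determines {vec.span {u'}, vec.span {v'}} X"
      unfolding g(2) using nz' ne' g by (intro determines_join) auto
    then show False
      using GL_indep_not_determines[OF S(1) that, of "{vec.span {u'}, vec.span {v'}}"] X S' by auto
  qed
  have "card ?T \<le> 3"
    by (simp add: card_insert_if)
  then obtain X Y where XY: "X \<in> S - ?T" "Y \<in> S - ?T" "X \<noteq> Y"
    using ex_two_more[OF S(2,3)] by blast
  then have "is_line X" "is_line Y"
    using GL_indep_is_line_or_plane[OF S(1)] noplane by auto
  then obtain x y where xy: "x \<noteq> 0" "y \<noteq> 0" "X = vec.span {x}" "Y = vec.span {y}"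
    by (auto simp: is_line_iff)
  obtain g where g: "g \<noteq> 0" "dot g x = 0" "dot g y = 0"
    using ex_dot2_eq_0 by blast
  have "determines {X, Y} (orth {g})"
    using xy g XY(3) by (auto intro: determines_join)
  then have dots: "dot g u' = 0 \<and> dot g v' = 0 \<and> dot g w' = 0"
    using XY by (intro collinear[of "{X, Y}"]) auto
  then have "vec.span {u', v'} = orth {g}"
    using nz' ne' g by (intro span_pair_eq_orth) auto
  then have "x \<in> vec.span {u', v'}"
    using g by simp
  then obtain a b where x: "x = a *s u' + b *s v'"
    by (auto simp: mem_span_pair)
  have "determines ?T X"
    unfolding determines_def
  proof (intro allI impI)
    fix A :: "'a ^ 3 ^ 3"
    assume A: "invertible A" "\<forall>U\<in>?T. GL_act A U = U"
    then have "\<exists>c. A *v u' = c *s u'" "\<exists>c. A *v v' = c *s v'" "\<exists>c. A *v w' = c *s w'"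
      by (simp_all add: stab_span_iff)
    then obtain c d e where cde: "A *v u' = c *s u'" "A *v v' = d *s v'" "A *v w' = e *s w'"
      by auto
    then have "c = e" "d = e"
      using eigenvalues_collinear[OF sum nz'(1,2) ne'(1)] by blast+
    then have "A *v x = e *s x"
      using cde by (simp add: x vec.add vec.scale vec.scale_right_distrib mult.commute)
    then show "GL_act A X = X"
      using A(1) by (auto simp: xy stab_span_iff)
  qed
  then show False
    using GL_indep_not_determines[OF S(1), of X ?T] XY S' by simp
qed

text \<open>Four lines, any three of them independent, form a projective frame. Its stabilizer
  consists of scalars, so the family would have only four members.\<close>

lemma GL_indep_card_lines:
  fixes S :: "('a::field ^ 3) set set"
  assumes S: "GL_indep S" "finite S" "card S \<ge> 5"
  shows "card {V \<in> S. is_line V} \<le> 3"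
proof (rule ccontr)
  assume "\<not> ?thesis"
  then have "4 \<le> card {V \<in> S. is_line V}"
    by linarith
  then obtain T where T: "T \<subseteq> {V \<in> S. is_line V}" "card T = 4" "finite T"
    by (rule obtain_subset_with_card_n)
  then obtain X T' where X: "T = insert X T'" "X \<notin> T'" "card T' = 3"
    using card_Suc_eq[of T 3] by auto
  then obtain U V W where UVW: "T' = {U, V, W}" "U \<noteq> V" "U \<noteq> W" "V \<noteq> W"
    by (metis card_3_iff)
  have lines: "is_line U" "is_line V" "is_line W" "is_line X"
    using T(1) unfolding X(1) UVW(1) by auto
  obtain u v w x where uvwx: "u \<noteq> 0" "v \<noteq> 0" "w \<noteq> 0" "x \<noteq> 0"
    "U = vec.span {u}" "V = vec.span {v}" "W = vec.span {w}" "X = vec.span {x}"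
    using lines unfolding is_line_iff by metis
  have mem: "{U, V, W, X} \<subseteq> S" "U \<noteq> V" "U \<noteq> W" "U \<noteq> X" "V \<noteq> W" "V \<noteq> X" "W \<noteq> X"
    using T(1) X(2) UVW(2-4) unfolding X(1) UVW(1) by auto
  have ind: "indep3 u v w" "indep3 x v w" "indep3 u x w" "indep3 u v x"
    using mem uvwx by (intro GL_indep_lines_indep3[OF S]; auto)+
  obtain a b c where x: "x = a *s u + b *s v + c *s w"
    using ind(1) indep3_iff_expand by metis
  \<comment> \<open>A vanishing coefficient would give a linear relation between \<open>x\<close>
    and two of the basis vectors; likewise for \<open>b\<close> and \<open>c\<close>.\<close>
  have a: "a \<noteq> 0"
  proof
    assume "a = 0"
    then have "(-1) *s x + b *s v + c *s w = 0"
      by (simp add: x)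
    then show False
      using ind(2) unfolding indep3_def by (metis neg_equal_0_iff_equal zero_neq_one)
  qed
  have b: "b \<noteq> 0"
  proof
    assume "b = 0"
    then have "a *s u + (-1) *s x + c *s w = 0"
      by (simp add: x)
    then show False
      using ind(3) unfolding indep3_def by (metis neg_equal_0_iff_equal zero_neq_one)
  qed
  have c: "c \<noteq> 0"
  proof
    assume "c = 0"
    then have "a *s u + b *s v + (-1) *s x = 0"
      by (simp add: x)
    then show False
      using ind(4) unfolding indep3_def by (metis neg_equal_0_iff_equal zero_neq_one)
  qed
  have "S = {U, V, W, X}"
  proof (rule GL_indep_scalar[OF S(1) mem(1)])
    fix A :: "'a ^ 3 ^ 3"
    assume A: "invertible A" "\<forall>U'\<in>{U, V, W, X}. GL_act A U' = U'"
    then have "\<exists>p. A *v u = p *s u" "\<exists>p. A *v v = p *s v" "\<exists>p. A *v w = p *s w" "\<exists>p. A *v x = p *s x"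
      by (simp_all add: uvwx stab_span_iff)
    then obtain p q r s where pqrs: "A *v u = p *s u" "A *v v = q *s v" "A *v w = r *s w" "A *v x = s *s x"
      by auto
    \<comment> \<open>The equation \<open>A *v x = s *s x\<close> is compared in the basis
      \<open>u\<close>, \<open>v\<close>, \<open>w\<close>; as no coefficient of \<open>x\<close> is
      zero, every eigenvalue equals \<open>s\<close>.\<close>
    have "(a * (p - s)) *s u + (b * (q - s)) *s v + (c * (r - s)) *s w = A *v x - s *s x"
      unfolding x by (simp add: vec.add vec.scale pqrs(1-3) vec.scale_right_distrib
          vec.scale_left_diff_distrib right_diff_distrib mult.commute)
    then have "(a * (p - s)) *s u + (b * (q - s)) *s v + (c * (r - s)) *s w = 0"
      using pqrs(4) by simp
    then have "a * (p - s) = 0 \<and> b * (q - s) = 0 \<and> c * (r - s) = 0"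
      using ind(1) unfolding indep3_def by blast
    then have ps: "p = s" "q = s" "r = s"
      using a b c by auto
    have "A *v y = s *s y" for y
    proof -
      obtain a' b' c' where y: "y = a' *s u + b' *s v + c' *s w"
        using ind(1) indep3_iff_expand by metis
      show ?thesis
        unfolding y by (simp add: vec.add vec.scale pqrs(1-3) ps vec.scale_right_distrib mult.commute)
    qed
    then show "\<exists>s. \<forall>y. A *v y = s *s y"
      by blast
  qed
  then have "card S = 4"
    using mem by simp
  then show False
    using S(3) by simp
qed

text \<open>A plane containing two of the lines would be their join. A plane containing none would
  force all three eigenvalues to agree with that of \<open>g\<close>, so these four members would
  have a scalar stabilizer and exhaust \<open>S\<close>.\<close>

lemma GL_indep_plane_basis:
  fixes u v w g :: "'a::field ^ 3"
  assumes S: "GL_indep S" "card S \<ge> 5"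
    "{vec.span {u}, vec.span {v}, vec.span {w}, orth {g}} \<subseteq> S"
    and ind: "indep3 u v w" and g: "g \<noteq> 0"
    and nz: "u \<noteq> 0" "v \<noteq> 0" "w \<noteq> 0"
    and ne: "vec.span {u} \<noteq> vec.span {v}" "vec.span {u} \<noteq> vec.span {w}" "vec.span {v} \<noteq> vec.span {w}"
  shows "dot g u = 0 \<and> dot g v \<noteq> 0 \<and> dot g w \<noteq> 0 \<or>
    dot g u \<noteq> 0 \<and> dot g v = 0 \<and> dot g w \<noteq> 0 \<or>
    dot g u \<noteq> 0 \<and> dot g v \<noteq> 0 \<and> dot g w = 0"
proof -
  have join: "dot g x \<noteq> 0 \<or> dot g y \<noteq> 0"
    if "x \<noteq> 0" "y \<noteq> 0" "vec.span {x} \<noteq> vec.span {y}" "vec.span {x} \<in> S" "vec.span {y} \<in> S" for x y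
  proof (rule ccontr)
    assume "\<not> ?thesis"
    then have "determines {vec.span {x}, vec.span {y}} (orth {g})"
      using that g by (intro determines_join) auto
    moreover have "orth {g} \<notin> {vec.span {x}, vec.span {y}}"
      using span_neq_orth[OF _ g] that by auto
    ultimately show False
      using GL_indep_not_determines[OF S(1), of "orth {g}" "{vec.span {x}, vec.span {y}}"] S(3) that(4,5)
      by simp
  qed
  have "\<not> (dot g u \<noteq> 0 \<and> dot g v \<noteq> 0 \<and> dot g w \<noteq> 0)"
  proof
    assume dots: "dot g u \<noteq> 0 \<and> dot g v \<noteq> 0 \<and> dot g w \<noteq> 0"
    have "S = {vec.span {u}, vec.span {v}, vec.span {w}, orth {g}}"
    proof (rule GL_indep_scalar[OF S(1,3)])
      fix A :: "'a ^ 3 ^ 3"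
      assume A: "invertible A"
        "\<forall>U\<in>{vec.span {u}, vec.span {v}, vec.span {w}, orth {g}}. GL_act A U = U"
      then have "\<exists>p. A *v u = p *s u" "\<exists>p. A *v v = p *s v" "\<exists>p. A *v w = p *s w"
        "\<exists>k. \<forall>x. dot g (A *v x) = k * dot g x"
        by (simp_all add: stab_span_iff stab_orth_iff)
      then obtain p q r k where pqr: "A *v u = p *s u" "A *v v = q *s v" "A *v w = r *s w"
        and k: "\<And>x. dot g (A *v x) = k * dot g x"
        by auto
      have eqs: "p = k" "q = k" "r = k"
        using k[of u] k[of v] k[of w] dots by (simp_all add: pqr)
      have "A *v y = k *s y" for y
      proof -
        obtain a b c where y: "y = a *s u + b *s v + c *s w"
          using ind indep3_iff_expand by metis
        show ?thesis
          unfolding y by (simp add: vec.add vec.scale pqr eqs vec.scale_right_distrib mult.commute)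
      qed
      then show "\<exists>s. \<forall>y. A *v y = s *s y"
        by blast
    qed
    moreover have "card {vec.span {u}, vec.span {v}, vec.span {w}, orth {g}} \<le> 4"
      by (simp add: card_insert_if)
    ultimately have "card S \<le> 4"
      by simp
    then show False
      using S(2) by simp
  qed
  moreover have "dot g u \<noteq> 0 \<or> dot g v \<noteq> 0" "dot g u \<noteq> 0 \<or> dot g w \<noteq> 0" "dot g v \<noteq> 0 \<or> dot g w \<noteq> 0"
    using join[of u v] join[of u w] join[of v w] nz ne S(3) by simp_all
  ultimately show ?thesis
    by argo
qed

section \<open>Families with three lines and two planes\<close>

lemma span_subset_orth: "vec.span {v} \<subseteq> orth {g} \<longleftrightarrow> dot g v = 0"
proof
  show "vec.span {v} \<subseteq> orth {g} \<Longrightarrow> dot g v = 0"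
    using vec.span_base[of v "{v}"] by auto
qed (auto simp: mem_span_singleton)

lemma lines3_planes2I:
  assumes "S = {vec.span {u}, vec.span {v}, vec.span {w}, orth {g}, orth {h}}"
    and "indep3 u v w" "u \<noteq> 0" "v \<noteq> 0" "w \<noteq> 0" "g \<noteq> 0" "h \<noteq> 0"
    and "dot g u = 0" "dot g v \<noteq> 0" "dot g w \<noteq> 0" "dot h u \<noteq> 0" "dot h v = 0" "dot h w \<noteq> 0"
  shows "lines3_planes2 S"
proof -
  define L where "L = (\<lambda>i::nat. if i = 1 then vec.span {u} else if i = 2 then vec.span {v} else vec.span {w})"
  define P where "P = (\<lambda>i::nat. if i = 1 then orth {g} else orth {h})"
  have "L 1 + L 2 + L 3 = UNIV"
    using assms(2) by (simp add: L_def indep3_iff_span_sum)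
  moreover have "\<forall>i\<in>{1,2,3}. is_line (L i)" "\<forall>j\<in>{1,2}. is_plane (P j)"
    using assms(3-7) by (auto simp: L_def P_def is_line_iff is_plane_iff)
  moreover have "S = {L 1, L 2, L 3, P 1, P 2}" "L 1 \<subseteq> P 1" "L 2 \<subseteq> P 2"
    "\<forall>i\<in>{1,2,3}. \<forall>j\<in>{1,2}. i \<noteq> j \<longrightarrow> \<not> L i \<subseteq> P j"
    using assms by (simp_all add: L_def P_def span_subset_orth)
  ultimately show ?thesis
    unfolding lines3_planes2_def by blast
qed

text \<open>The functional \<open>g\<close> ties the eigenvalues of \<open>v\<close> and
  \<open>w\<close> together, and \<open>h\<close> those of \<open>u\<close> and \<open>w\<close>.
  All three agree, so the stabilizer of the five members is scalar and they exhaust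
  \<open>S\<close>.\<close>

lemma GL_indep_lines3_planes2_labelled:
  fixes u v w g h :: "'a::field ^ 3"
  assumes S: "GL_indep S" "{vec.span {u}, vec.span {v}, vec.span {w}, orth {g}, orth {h}} \<subseteq> S"
    and ind: "indep3 u v w"
    and nz: "u \<noteq> 0" "v \<noteq> 0" "w \<noteq> 0" "g \<noteq> 0" "h \<noteq> 0"
    and dots: "dot g u = 0" "dot g v \<noteq> 0" "dot g w \<noteq> 0" "dot h u \<noteq> 0" "dot h v = 0" "dot h w \<noteq> 0"
  shows "lines3_planes2 S"
proof -
  have "S = {vec.span {u}, vec.span {v}, vec.span {w}, orth {g}, orth {h}}"
  proof (rule GL_indep_scalar[OF S])
    fix A :: "'a ^ 3 ^ 3"
    assume A: "invertible A"
      "\<forall>U\<in>{vec.span {u}, vec.span {v}, vec.span {w}, orth {g}, orth {h}}. GL_act A U = U"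
    then have "\<exists>p. A *v u = p *s u" "\<exists>p. A *v v = p *s v" "\<exists>p. A *v w = p *s w"
      "\<exists>k. \<forall>x. dot g (A *v x) = k * dot g x" "\<exists>k. \<forall>x. dot h (A *v x) = k * dot h x"
      by (simp_all add: stab_span_iff stab_orth_iff)
    then obtain p q r k l where pqr: "A *v u = p *s u" "A *v v = q *s v" "A *v w = r *s w"
      and k: "\<forall>x. dot g (A *v x) = k * dot g x" and l: "\<forall>x. dot h (A *v x) = l * dot h x"
      by metis
    have eqs: "p = l" "q = k" "r = k" "r = l"
      using k[rule_format, of v] k[rule_format, of w] l[rule_format, of u] l[rule_format, of w] dots
      by (simp_all add: pqr)
    have "A *v y = r *s y" for y
    proof -
      obtain a b c where y: "y = a *s u + b *s v + c *s w"
        using ind indep3_iff_expand by metis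
      have "p = r" "q = r"
        using eqs by auto
      then show ?thesis
        unfolding y by (simp add: vec.add vec.scale pqr vec.scale_right_distrib mult.commute)
    qed
    then show "\<exists>s. \<forall>y. A *v y = s *s y"
      by blast
  qed
  then show ?thesis
    using ind nz dots by (rule lines3_planes2I)
qed

lemma indep3_perm:
  assumes "indep3 u v w"
  shows "indep3 u w v" "indep3 v u w" "indep3 v w u" "indep3 w u v" "indep3 w v u"
  using assms by (auto simp: indep3_iff_orth)

lemma GL_indep_lines3_planes2:
  fixes S :: "('a::field ^ 3) set set"
  assumes S: "GL_indep S" "finite S" "card S \<ge> 5"
    and "card {V \<in> S. is_line V} \<ge> 3" "card {V \<in> S. is_plane V} \<ge> 2"
  shows "lines3_planes2 S"
proof -
  obtain T where T: "T \<subseteq> {V \<in> S. is_line V}" "card T = 3" "finite T"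
    using assms(4) by (rule obtain_subset_with_card_n)
  then obtain U V W where UVW: "T = {U, V, W}" "U \<noteq> V" "U \<noteq> W" "V \<noteq> W"
    by (metis card_3_iff)
  obtain T' where T': "T' \<subseteq> {V \<in> S. is_plane V}" "card T' = 2" "finite T'"
    using assms(5) by (rule obtain_subset_with_card_n)
  then obtain P Q where PQ: "T' = {P, Q}" "P \<noteq> Q"
    by (metis card_2_iff)
  have mem: "U \<in> S" "V \<in> S" "W \<in> S" "P \<in> S" "Q \<in> S"
    and lp: "is_line U" "is_line V" "is_line W" "is_plane P" "is_plane Q"
    using T T' UVW PQ by auto
  obtain u v w g h where nz: "u \<noteq> 0" "v \<noteq> 0" "w \<noteq> 0" "g \<noteq> 0" "h \<noteq> 0"
    and eqs: "U = vec.span {u}" "V = vec.span {v}" "W = vec.span {w}" "P = orth {g}" "Q = orth {h}"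
    using lp by (auto simp: is_line_iff is_plane_iff)
  have ind: "indep3 u v w"
    using mem UVW nz eqs by (intro GL_indep_lines_indep3[OF S]) auto
  have "dot g u = 0 \<and> dot g v \<noteq> 0 \<and> dot g w \<noteq> 0 \<or>
      dot g u \<noteq> 0 \<and> dot g v = 0 \<and> dot g w \<noteq> 0 \<or>
      dot g u \<noteq> 0 \<and> dot g v \<noteq> 0 \<and> dot g w = 0"
    using mem UVW nz eqs ind by (intro GL_indep_plane_basis[OF S(1,3)]) auto
  moreover have "dot h u = 0 \<and> dot h v \<noteq> 0 \<and> dot h w \<noteq> 0 \<or>
      dot h u \<noteq> 0 \<and> dot h v = 0 \<and> dot h w \<noteq> 0 \<or>
      dot h u \<noteq> 0 \<and> dot h v \<noteq> 0 \<and> dot h w = 0"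
    using mem UVW nz eqs ind by (intro GL_indep_plane_basis[OF S(1,3)]) auto
  \<comment> \<open>A line of the family lying in both planes would be their intersection, hence
    determined by them.\<close>
  moreover have meet: "\<not> (dot g x = 0 \<and> dot h x = 0)" if "x \<noteq> 0" "vec.span {x} \<in> S" for x
  proof
    assume "dot g x = 0 \<and> dot h x = 0"
    then have "determines {P, Q} (vec.span {x})"
      unfolding eqs using that nz PQ eqs by (intro determines_meet) auto
    moreover have "vec.span {x} \<notin> {P, Q}"
      using span_neq_orth that nz eqs by auto
    ultimately show False
      using GL_indep_not_determines[OF S(1) that(2), of "{P, Q}"] mem by simp
  qed
  have "\<not> (dot g u = 0 \<and> dot h u = 0)" "\<not> (dot g v = 0 \<and> dot h v = 0)" "\<not> (dot g w = 0 \<and> dot h w = 0)"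
    using meet nz mem eqs by auto
  \<comment> \<open>The two planes contain different lines among the three: six ordered choices,
    each reduced to the labelled lemma by permuting \<open>u\<close>, \<open>v\<close>,
    \<open>w\<close>.\<close>
  ultimately consider
      "dot g u = 0" "dot g v \<noteq> 0" "dot g w \<noteq> 0" "dot h u \<noteq> 0" "dot h v = 0" "dot h w \<noteq> 0"
    | "dot g u = 0" "dot g v \<noteq> 0" "dot g w \<noteq> 0" "dot h u \<noteq> 0" "dot h v \<noteq> 0" "dot h w = 0"
    | "dot g u \<noteq> 0" "dot g v = 0" "dot g w \<noteq> 0" "dot h u = 0" "dot h v \<noteq> 0" "dot h w \<noteq> 0"
    | "dot g u \<noteq> 0" "dot g v = 0" "dot g w \<noteq> 0" "dot h u \<noteq> 0" "dot h v \<noteq> 0" "dot h w = 0"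
    | "dot g u \<noteq> 0" "dot g v \<noteq> 0" "dot g w = 0" "dot h u = 0" "dot h v \<noteq> 0" "dot h w \<noteq> 0"
    | "dot g u \<noteq> 0" "dot g v \<noteq> 0" "dot g w = 0" "dot h u \<noteq> 0" "dot h v = 0" "dot h w \<noteq> 0"
    by argo
  then show ?thesis
  proof cases
    case 1
    then show ?thesis
      using ind nz mem eqs by
        (intro GL_indep_lines3_planes2_labelled[OF S(1), of u v w g h]) auto
  next
    case 2
    then show ?thesis
      using indep3_perm[OF ind] nz mem eqs by
        (intro GL_indep_lines3_planes2_labelled[OF S(1), of u w v g h]) auto
  next
    case 3
    then show ?thesis
      using indep3_perm[OF ind] nz mem eqs by
        (intro GL_indep_lines3_planes2_labelled[OF S(1), of v u w g h]) auto
  next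
    case 4
    then show ?thesis
      using indep3_perm[OF ind] nz mem eqs by
        (intro GL_indep_lines3_planes2_labelled[OF S(1), of v w u g h]) auto
  next
    case 5
    then show ?thesis
      using indep3_perm[OF ind] nz mem eqs by
        (intro GL_indep_lines3_planes2_labelled[OF S(1), of w u v g h]) auto
  next
    case 6
    then show ?thesis
      using indep3_perm[OF ind] nz mem eqs by
        (intro GL_indep_lines3_planes2_labelled[OF S(1), of w v u g h]) auto
  qed
qed

section \<open>Duality\<close>

lemma orth_orth:
  fixes V :: "('a::field ^ 3) set"
  assumes "is_line V \<or> is_plane V"
  shows "orth (orth V) = V"
  using assms by (auto simp: is_line_iff is_plane_iff orth_span_singleton orth_orth_singleton)

lemma is_plane_orth: "is_line V \<Longrightarrow> is_plane (orth V)"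
  by (auto simp: is_line_iff is_plane_iff orth_span_singleton)

lemma is_line_orth: "is_plane V \<Longrightarrow> is_line (orth V)"
  by (auto simp: is_line_iff is_plane_iff orth_orth_singleton)

lemma orth_antimono: "U \<subseteq> V \<Longrightarrow> orth V \<subseteq> orth U"
  by (auto simp: orth_def)

lemma orth_subset_orth_iff:
  fixes U V :: "('a::field ^ 3) set"
  assumes "is_line U \<or> is_plane U" "is_line V \<or> is_plane V"
  shows "orth U \<subseteq> orth V \<longleftrightarrow> V \<subseteq> U"
  using orth_antimono[of V U] orth_antimono[of "orth U" "orth V"] orth_orth assms by auto

lemma inj_on_orth:
  fixes S :: "('a::field ^ 3) set set"
  assumes "\<And>V. V \<in> S \<Longrightarrow> is_line V \<or> is_plane V"
  shows "inj_on orth S"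
  using assms orth_orth by (metis inj_onI)

lemma orth_image_orth_image:
  fixes S :: "('a::field ^ 3) set set"
  assumes "\<And>V. V \<in> S \<Longrightarrow> is_line V \<or> is_plane V"
  shows "orth ` orth ` S = S"
proof -
  have "(\<lambda>V. orth (orth V)) ` S = id ` S"
    by (rule image_cong) (use assms orth_orth in auto)
  then show ?thesis
    by (simp add: image_image)
qed

text \<open>The inverse transpose of a matrix that moves \<open>V\<close> alone moves
  \<open>orth V\<close> alone.\<close>

lemma GL_indep_orth_image:
  fixes S :: "('a::field ^ 3) set set"
  assumes S: "GL_indep S"
  shows "GL_indep (orth ` S)"
  unfolding act_indep_def
proof (intro conjI ballI)
  show "orth ` S \<subseteq> Sub"
    by (auto simp: Sub_def subspace_orth)
  fix V' assume "V' \<in> orth ` S"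
  then obtain V where V: "V \<in> S" "V' = orth V"
    by auto
  have lp: "is_line V \<or> is_plane V"
    using GL_indep_is_line_or_plane[OF S V(1)] .
  obtain A where A: "A \<in> GL" "\<forall>U\<in>S - {V}. GL_act A U = U" "GL_act A V \<noteq> V"
    using S V(1) unfolding act_indep_def by blast
  then obtain B where B: "A ** B = mat 1" "B ** A = mat 1"
    by (auto simp: GL_def invertible_def)
  have tr: "transpose B ** transpose A = mat 1" "transpose A ** transpose B = mat 1"
    using B by (metis matrix_transpose_mul transpose_mat)+
  have "transpose B \<in> GL"
    using tr unfolding GL_def invertible_def by blast
  moreover have "\<forall>U'\<in>orth ` S - {V'}. GL_act (transpose B) U' = U'"
  proof
    fix U' assume U': "U' \<in> orth ` S - {V'}"
    then obtain U where "U \<in> S" "U' = orth U" "U \<noteq> V"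
      using V by auto
    then show "GL_act (transpose B) U' = U'"
      using orth_GL_act[OF B, of U] A(2) by simp
  qed
  moreover have "GL_act (transpose B) V' \<noteq> V'"
  proof
    \<comment> \<open>The inverse transpose of \<open>transpose B\<close> is \<open>A\<close> again,
      so taking complements once more would make \<open>A\<close> fix \<open>V\<close>.\<close>
    assume "GL_act (transpose B) V' = V'"
    then have "orth V' = GL_act A (orth V')"
      using orth_GL_act[OF tr, of V'] by simp
    then show False
      using A(3) V(2) orth_orth[OF lp] by simp
  qed
  ultimately show "\<exists>a\<in>GL. (\<forall>U'\<in>orth ` S - {V'}. GL_act a U' = U') \<and> GL_act a V' \<noteq> V'"
    by blast
qed

text \<open>Both sides express independence of the three generators, once as spanning and once as a
  trivial common kernel.\<close>

lemma span_sum_eq_UNIV_iff: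
  fixes U V W :: "('a::field ^ 3) set"
  assumes "is_line U" "is_line V" "is_line W"
  shows "U + V + W = UNIV \<longleftrightarrow> orth U \<inter> orth V \<inter> orth W = {0}"
proof -
  obtain u v w where eqs: "U = vec.span {u}" "V = vec.span {v}" "W = vec.span {w}"
    using assms unfolding is_line_iff by metis
  have "0 \<in> orth {u} \<inter> orth {v} \<inter> orth {w}"
    by simp
  then have "orth {u} \<inter> orth {v} \<inter> orth {w} = {0} \<longleftrightarrow>
      (\<forall>x. dot u x = 0 \<and> dot v x = 0 \<and> dot w x = 0 \<longrightarrow> x = 0)"
    unfolding set_eq_iff Int_iff mem_orth_singleton by blast
  then show ?thesis
    unfolding eqs orth_span_singleton indep3_iff_span_sum[symmetric] indep3_iff_orth by blast
qed

text \<open>Complements reverse inclusions, so \<open>orth (P i)\<close> becomes a line inside the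
  plane \<open>orth (L i)\<close> and the index pairing is kept.\<close>

lemma planes3_lines2_orth_image:
  assumes "lines3_planes2 S"
  shows "planes3_lines2 (orth ` S)"
proof -
  obtain L P :: "nat \<Rightarrow> ('a ^ 3) set" where S: "S = {L 1, L 2, L 3, P 1, P 2}"
    and L: "\<forall>i\<in>{1,2,3}. is_line (L i)" and P: "\<forall>j\<in>{1,2}. is_plane (P j)"
    and LP: "L 1 \<subseteq> P 1" "L 2 \<subseteq> P 2" and sum: "L 1 + L 2 + L 3 = UNIV"
    and nLP: "\<forall>i\<in>{1,2,3}. \<forall>j\<in>{1,2}. i \<noteq> j \<longrightarrow> \<not> L i \<subseteq> P j"
    using assms unfolding lines3_planes2_def by (elim exE conjE) (rule that)
  have "\<forall>j\<in>{1,2,3}. is_plane (orth (L j))" "\<forall>i\<in>{1,2}. is_line (orth (P i))"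
    using L P is_plane_orth is_line_orth by blast+
  moreover have "orth ` S = {orth (L 1), orth (L 2), orth (L 3), orth (P 1), orth (P 2)}"
    by (simp add: S)
  moreover have "orth (P 1) \<subseteq> orth (L 1)" "orth (P 2) \<subseteq> orth (L 2)"
    by (intro orth_antimono LP)+
  moreover have "orth (L 1) \<inter> orth (L 2) \<inter> orth (L 3) = {0}"
    using span_sum_eq_UNIV_iff[of "L 1" "L 2" "L 3"] L sum by simp
  moreover have "\<forall>i\<in>{1,2}. \<forall>j\<in>{1,2,3}. i \<noteq> j \<longrightarrow> \<not> orth (P i) \<subseteq> orth (L j)"
    using nLP L P by (simp add: orth_subset_orth_iff)
  ultimately show ?thesis
    unfolding planes3_lines2_def
    by (intro exI[of _ "\<lambda>i. orth (P i)"] exI[of _ "\<lambda>i. orth (L i)"]) simp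
qed

lemma lines3_planes2_orth_image:
  assumes "planes3_lines2 S"
  shows "lines3_planes2 (orth ` S)"
proof -
  obtain L P :: "nat \<Rightarrow> ('a ^ 3) set" where S: "S = {P 1, P 2, P 3, L 1, L 2}"
    and P: "\<forall>j\<in>{1,2,3}. is_plane (P j)" and L: "\<forall>i\<in>{1,2}. is_line (L i)"
    and LP: "L 1 \<subseteq> P 1" "L 2 \<subseteq> P 2" and int: "P 1 \<inter> P 2 \<inter> P 3 = {0}"
    and nLP: "\<forall>i\<in>{1,2}. \<forall>j\<in>{1,2,3}. i \<noteq> j \<longrightarrow> \<not> L i \<subseteq> P j"
    using assms unfolding planes3_lines2_def by (elim exE conjE) (rule that)
  have "\<forall>i\<in>{1,2,3}. is_line (orth (P i))" "\<forall>j\<in>{1,2}. is_plane (orth (L j))"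
    using L P is_plane_orth is_line_orth by blast+
  moreover have "orth ` S = {orth (P 1), orth (P 2), orth (P 3), orth (L 1), orth (L 2)}"
    by (simp add: S)
  moreover have "orth (P 1) \<subseteq> orth (L 1)" "orth (P 2) \<subseteq> orth (L 2)"
    by (intro orth_antimono LP)+
  moreover have "orth (P 1) + orth (P 2) + orth (P 3) = UNIV"
    using span_sum_eq_UNIV_iff[of "orth (P 1)" "orth (P 2)" "orth (P 3)"] P int
    by (simp add: is_line_orth orth_orth)
  moreover have "\<forall>i\<in>{1,2,3}. \<forall>j\<in>{1,2}. i \<noteq> j \<longrightarrow> \<not> orth (P i) \<subseteq> orth (L j)"
    using nLP L P by (simp add: orth_subset_orth_iff)
  ultimately show ?thesis
    unfolding lines3_planes2_def
    by (intro exI[of _ "\<lambda>i. orth (P i)"] exI[of _ "\<lambda>i. orth (L i)"]) simp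
qed

text \<open>The bound of three lines, applied to the complements, also bounds the planes by three.
  So there are three of one kind and at least two of the other; when the planes are three, the
  argument runs on the complements and is carried back.\<close>

lemma GL_indep_five_cases:
  fixes S :: "('a::field ^ 3) set set"
  assumes S: "GL_indep S" "finite S" "card S \<ge> 5"
  shows "lines3_planes2 S \<or> planes3_lines2 S"
proof -
  note lp = GL_indep_is_line_or_plane[OF S(1)]
  let ?l = "card {V \<in> S. is_line V}" and ?p = "card {V \<in> S. is_plane V}"
  have inj: "inj_on orth S"
    using lp by (rule inj_on_orth)
  have "S = {V \<in> S. is_line V} \<union> {V \<in> S. is_plane V}"
    using lp by auto
  then have "card S = ?l + ?p"
    using S(2) line_not_plane by (subst card_Un_disjoint[symmetric]) auto
  then have lp5: "?l + ?p \<ge> 5"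
    using S(3) by simp
  have S': "GL_indep (orth ` S)" "finite (orth ` S)" "card (orth ` S) \<ge> 5"
    using S GL_indep_orth_image by (simp_all add: card_image[OF inj])
  have "{V \<in> orth ` S. is_line V} = orth ` {V \<in> S. is_plane V}"
    using lp line_not_plane is_plane_orth is_line_orth by blast
  then have l': "card {V \<in> orth ` S. is_line V} = ?p"
    using inj by (simp add: card_image inj_on_subset)
  have "{V \<in> orth ` S. is_plane V} = orth ` {V \<in> S. is_line V}"
    using lp line_not_plane is_plane_orth is_line_orth by blast
  then have p': "card {V \<in> orth ` S. is_plane V} = ?l"
    using inj by (simp add: card_image inj_on_subset)
  have "?l \<le> 3" "?p \<le> 3"
    using GL_indep_card_lines[OF S] GL_indep_card_lines[OF S'] l' by auto
  then consider "?l \<ge> 3" "?p \<ge> 2" | "?p \<ge> 3" "?l \<ge> 2"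
    using lp5 by linarith
  then show ?thesis
  proof cases
    case 1
    then show ?thesis
      using GL_indep_lines3_planes2[OF S] by simp
  next
    case 2
    then have "lines3_planes2 (orth ` S)"
      using GL_indep_lines3_planes2[OF S'] l' p' by simp
    then have "planes3_lines2 (orth ` orth ` S)"
      by (rule planes3_lines2_orth_image)
    then show ?thesis
      using orth_image_orth_image[OF lp] by simp
  qed
qed

section \<open>The five-element configurations are independent\<close>

lemma vector3_mult:
  "(vector [vector [a, b, c], vector [d, e, f], vector [p, q, r]] :: 'a::field ^ 3 ^ 3) *v y =
    vector [a * y $ 1 + b * y $ 2 + c * y $ 3, d * y $ 1 + e * y $ 2 + f * y $ 3,
      p * y $ 1 + q * y $ 2 + r * y $ 3]"
  by (simp add: vec_eq_iff matrix_vector_mult_def sum_3 forall_3)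

lemma invertible_vector3:
  "invertible (vector [vector [a, b, c], vector [d, e, f], vector [p, q, r]] :: 'a::field ^ 3 ^ 3) \<longleftrightarrow>
    a * e * r + b * f * p + c * d * q - a * f * q - b * d * r - c * e * p \<noteq> 0"
  by (simp add: invertible_det_nz det_3)

text \<open>\<open>A\<close> is the conjugate of \<open>D\<close> by the matrix \<open>M\<close>
  with columns \<open>u\<close>, \<open>v\<close>, \<open>w\<close>. In these coordinates the lines
  are the axes and \<open>g\<close>, \<open>h\<close> become \<open>y $ 2 - y $ 3\<close> and
  \<open>y $ 1 - y $ 3\<close>, so all five conditions can be checked on a concrete
  \<open>D\<close>.\<close>

lemma ex_conjugate:
  fixes u v w g h :: "'a::field ^ 3" and D :: "'a ^ 3 ^ 3"
  assumes ind: "indep3 u v w" and D: "invertible D"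
    and g: "dot g u = 0" "dot g v = 1" "dot g w = -1"
    and h: "dot h u = 1" "dot h v = 0" "dot h w = -1"
  obtains A where "A \<in> GL"
    "GL_act A (vec.span {u}) = vec.span {u} \<longleftrightarrow> (\<exists>c. D *v vector [1, 0, 0] = c *s vector [1, 0, 0])"
    "GL_act A (vec.span {v}) = vec.span {v} \<longleftrightarrow> (\<exists>c. D *v vector [0, 1, 0] = c *s vector [0, 1, 0])"
    "GL_act A (vec.span {w}) = vec.span {w} \<longleftrightarrow> (\<exists>c. D *v vector [0, 0, 1] = c *s vector [0, 0, 1])"
    "GL_act A (orth {g}) = orth {g} \<longleftrightarrow>
      (\<exists>k. \<forall>y. (D *v y) $ 2 - (D *v y) $ 3 = k * (y $ 2 - y $ 3))"
    "GL_act A (orth {h}) = orth {h} \<longleftrightarrow>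
      (\<exists>k. \<forall>y. (D *v y) $ 1 - (D *v y) $ 3 = k * (y $ 1 - y $ 3))"
proof -
  define M where "M = transpose (vector [u, v, w] :: 'a ^ 3 ^ 3)"
  have M: "M *v y = y $ 1 *s u + y $ 2 *s v + y $ 3 *s w" for y
    unfolding M_def by (rule columns3_mult)
  have "invertible M"
    using ind by (simp only: M_def indep3_iff_columns)
  then obtain N where N: "M ** N = mat 1" "N ** M = mat 1"
    by (auto simp: invertible_def)
  have NM: "N *v (M *v y) = y" and MN: "M *v (N *v y) = y" for y
    using N by (simp_all add: matrix_vector_mul_assoc)
  have invN: "invertible N"
    using N by (auto simp: invertible_def)
  define A where "A = M ** D ** N"
  have A: "invertible A"
    using \<open>invertible M\<close> D invN by (simp add: A_def invertible_mult)
  have AM: "A *v (M *v y) = M *v (D *v y)" for y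
    by (simp add: A_def NM flip: matrix_vector_mul_assoc)
  have inj: "M *v x = M *v y \<longleftrightarrow> x = y" for x y
    by (metis NM)
  have sp: "GL_act A (vec.span {M *v y}) = vec.span {M *v y} \<longleftrightarrow> (\<exists>c. D *v y = c *s y)" for y
    unfolding stab_span_iff[OF A] AM vec.scale[symmetric] inj ..
  have ort: "GL_act A (orth {f}) = orth {f} \<longleftrightarrow>
      (\<exists>k. \<forall>y. dot f (M *v (D *v y)) = k * dot f (M *v y))" for f
    unfolding stab_orth_iff[OF A] AM[symmetric] by (metis MN)
  have gM: "dot g (M *v y) = y $ 2 - y $ 3" and hM: "dot h (M *v y) = y $ 1 - y $ 3" for y
    by (simp_all add: M g h)
  have uvw: "M *v vector [1, 0, 0] = u" "M *v vector [0, 1, 0] = v" "M *v vector [0, 0, 1] = w"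
    by (simp_all add: M)
  show ?thesis
  proof (rule that)
    show "A \<in> GL"
      using A by (simp add: GL_def)
  qed (use sp[of "vector [1, 0, 0]"] sp[of "vector [0, 1, 0]"] sp[of "vector [0, 0, 1]"]
      in \<open>simp_all only: uvw ort gM hM\<close>)
qed

lemma normalized_config_indep:
  fixes u v w g h :: "'a::field ^ 3"
  assumes ind: "indep3 u v w"
    and g: "dot g u = 0" "dot g v = 1" "dot g w = -1"
    and h: "dot h u = 1" "dot h v = 0" "dot h w = -1"
    and c: "(c::'a) \<noteq> 0" "c \<noteq> 1"
  shows "GL_indep {vec.span {u}, vec.span {v}, vec.span {w}, orth {g}, orth {h}}"
    (is "GL_indep ?S")
proof -
  note conj = ex_conjugate[OF ind _ g h]
  have eqs: "((vector [x, y, z] :: 'a ^ 3) = p *s vector [x', y', z']) \<longleftrightarrow>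
      x = p * x' \<and> y = p * y' \<and> z = p * z'" for x y z p x' y' z'
    by (simp add: vec_eq_iff forall_3)
  \<comment> \<open>In these coordinates the two planes meet in the line of \<open>(1, 1, 1)\<close>; adding \<open>(c - 1) y\<^sub>i\<close>
    times this vector to \<open>y\<close> preserves both planes and moves only the \<open>i\<close>-th coordinate axis.\<close>
  obtain A1 where A1: "A1 \<in> GL" "GL_act A1 (vec.span {u}) \<noteq> vec.span {u}"
    "GL_act A1 (vec.span {v}) = vec.span {v}" "GL_act A1 (vec.span {w}) = vec.span {w}"
    "GL_act A1 (orth {g}) = orth {g}" "GL_act A1 (orth {h}) = orth {h}"
    by (rule conj[of "vector [vector [c, 0, 0], vector [c - 1, 1, 0], vector [c - 1, 0, 1]]"])
      (use c in \<open>auto simp: vector3_mult invertible_vector3 eqs algebra_simps intro!: exI[of _ 1]\<close>)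
  obtain A2 where A2: "A2 \<in> GL" "GL_act A2 (vec.span {u}) = vec.span {u}"
    "GL_act A2 (vec.span {v}) \<noteq> vec.span {v}" "GL_act A2 (vec.span {w}) = vec.span {w}"
    "GL_act A2 (orth {g}) = orth {g}" "GL_act A2 (orth {h}) = orth {h}"
    by (rule conj[of "vector [vector [1, c - 1, 0], vector [0, c, 0], vector [0, c - 1, 1]]"])
      (use c in \<open>auto simp: vector3_mult invertible_vector3 eqs algebra_simps intro!: exI[of _ 1]\<close>)
  obtain A3 where A3: "A3 \<in> GL" "GL_act A3 (vec.span {u}) = vec.span {u}"
    "GL_act A3 (vec.span {v}) = vec.span {v}" "GL_act A3 (vec.span {w}) \<noteq> vec.span {w}"
    "GL_act A3 (orth {g}) = orth {g}" "GL_act A3 (orth {h}) = orth {h}"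
    by (rule conj[of "vector [vector [1, 0, c - 1], vector [0, 1, c - 1], vector [0, 0, c]]"])
      (use c in \<open>auto simp: vector3_mult invertible_vector3 eqs algebra_simps intro!: exI[of _ 1]\<close>)
  \<comment> \<open>A multiple of \<open>y - z\<close> has opposite coefficients, which
    \<open>c * y - z\<close> has not, because \<open>c\<close> is not 1.\<close>
  have c': "\<not> (\<exists>k. \<forall>y::'a ^ 3. c * y $ 2 - y $ 3 = k * (y $ 2 - y $ 3))"
    "\<not> (\<exists>k. \<forall>y::'a ^ 3. c * y $ 1 - y $ 3 = k * (y $ 1 - y $ 3))"
  proof -
    have "\<exists>y z. c * y - z \<noteq> k * (y - z)" for k
    proof (cases "k = 1")
      case True
      then show ?thesis
        using c(2) by (intro exI[of _ 1] exI[of _ 0]) simp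
    next
      case False
      then show ?thesis
        by (intro exI[of _ 0] exI[of _ 1]) simp
    qed
    then show "\<not> (\<exists>k. \<forall>y::'a ^ 3. c * y $ 2 - y $ 3 = k * (y $ 2 - y $ 3))"
      "\<not> (\<exists>k. \<forall>y::'a ^ 3. c * y $ 1 - y $ 3 = k * (y $ 1 - y $ 3))"
      by (simp_all add: forall_vector_3)
  qed
  \<comment> \<open>Diagonal matrices fix all three axes. The entry \<open>c\<close> in second place
    leaves \<open>y $ 1 - y $ 3\<close> unchanged and moves only \<open>orth {g}\<close>; for
    \<open>A5\<close> it stands in first place and moves only \<open>orth {h}\<close>.\<close>
  obtain A4 where A4: "A4 \<in> GL" "GL_act A4 (vec.span {u}) = vec.span {u}"
    "GL_act A4 (vec.span {v}) = vec.span {v}" "GL_act A4 (vec.span {w}) = vec.span {w}"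
    "GL_act A4 (orth {g}) \<noteq> orth {g}" "GL_act A4 (orth {h}) = orth {h}"
    by (rule conj[of "vector [vector [1, 0, 0], vector [0, c, 0], vector [0, 0, 1]]"])
      (use c c' in \<open>auto simp: vector3_mult invertible_vector3 eqs intro!: exI[of _ 1]\<close>)
  obtain A5 where A5: "A5 \<in> GL" "GL_act A5 (vec.span {u}) = vec.span {u}"
    "GL_act A5 (vec.span {v}) = vec.span {v}" "GL_act A5 (vec.span {w}) = vec.span {w}"
    "GL_act A5 (orth {g}) = orth {g}" "GL_act A5 (orth {h}) \<noteq> orth {h}"
    by (rule conj[of "vector [vector [c, 0, 0], vector [0, 1, 0], vector [0, 0, 1]]"])
      (use c c' in \<open>auto simp: vector3_mult invertible_vector3 eqs intro!: exI[of _ 1]\<close>)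
  have moves: "\<exists>a\<in>GL. (\<forall>U\<in>?S - {V}. GL_act a U = U) \<and> GL_act a V \<noteq> V" if "V \<in> ?S" for V
  proof -
    from that consider "V = vec.span {u}" | "V = vec.span {v}" | "V = vec.span {w}"
      | "V = orth {g}" | "V = orth {h}"
      by auto
    then show ?thesis
    proof cases
      case 1
      then show ?thesis
        using A1 by (intro bexI[of _ A1]) auto
    next
      case 2
      then show ?thesis
        using A2 by (intro bexI[of _ A2]) auto
    next
      case 3
      then show ?thesis
        using A3 by (intro bexI[of _ A3]) auto
    next
      case 4
      then show ?thesis
        using A4 by (intro bexI[of _ A4]) auto
    next
      case 5
      then show ?thesis
        using A5 by (intro bexI[of _ A5]) auto
    qed
  qed
  show ?thesis
    unfolding act_indep_def by (intro conjI ballI moves) (simp_all add: Sub_def subspace_orth)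
qed

lemma orth_scale: "c \<noteq> 0 \<Longrightarrow> orth {c *s g} = orth {g}"
  by (auto simp: orth_def)

lemma config_indep:
  fixes u v w g h :: "'a::field ^ 3"
  assumes ind: "indep3 u v w"
    and g: "dot g u = 0" "dot g v \<noteq> 0" "dot g w \<noteq> 0"
    and h: "dot h u \<noteq> 0" "dot h v = 0" "dot h w \<noteq> 0"
    and c: "(c::'a) \<noteq> 0" "c \<noteq> 1"
  shows "GL_indep {vec.span {u}, vec.span {v}, vec.span {w}, orth {g}, orth {h}}"
proof -
  \<comment> \<open>\<open>p\<close> and \<open>q\<close> make the value of \<open>h\<close> at
    \<open>p *s u\<close>, and of \<open>g\<close> at \<open>q *s v\<close>, opposite to the value
    at \<open>w\<close>; then \<open>r\<close> and \<open>s\<close> scale the values at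
    \<open>w\<close> to -1.\<close>
  define p q where "p = - dot h w / dot h u" and "q = - dot g w / dot g v"
  define r s where "r = - 1 / dot g w" and "s = - 1 / dot h w"
  have nz: "p \<noteq> 0" "q \<noteq> 0" "r \<noteq> 0" "s \<noteq> 0"
    using g h by (simp_all add: p_def q_def r_def s_def)
  have "indep3 (p *s u) (q *s v) w"
    using ind nz by (simp add: indep3_iff_orth)
  then have "GL_indep {vec.span {p *s u}, vec.span {q *s v}, vec.span {w}, orth {r *s g}, orth {s *s h}}"
    by (rule normalized_config_indep[OF _ _ _ _ _ _ _ c])
      (use g h in \<open>simp_all add: p_def q_def r_def s_def\<close>)
  then show ?thesis
    using nz by (simp add: orth_scale span_singleton_eqI[OF refl])
qed

lemma lines3_planes2_indep:
  fixes c :: "'a::field" and S :: "('a ^ 3) set set"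
  assumes "lines3_planes2 S" "c \<noteq> 0" "c \<noteq> 1"
  shows "GL_indep S"
proof -
  obtain L P :: "nat \<Rightarrow> ('a ^ 3) set" where S: "S = {L 1, L 2, L 3, P 1, P 2}"
    and L: "\<forall>i\<in>{1,2,3}. is_line (L i)" and P: "\<forall>j\<in>{1,2}. is_plane (P j)"
    and LP: "L 1 \<subseteq> P 1" "L 2 \<subseteq> P 2" and sum: "L 1 + L 2 + L 3 = UNIV"
    and nLP: "\<forall>i\<in>{1,2,3}. \<forall>j\<in>{1,2}. i \<noteq> j \<longrightarrow> \<not> L i \<subseteq> P j"
    using assms(1) unfolding lines3_planes2_def by (elim exE conjE) (rule that)
  have "is_line (L 1)" "is_line (L 2)" "is_line (L 3)" "is_plane (P 1)" "is_plane (P 2)"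
    using L P by blast+
  then obtain u v w g h where eqs: "L 1 = vec.span {u}" "L 2 = vec.span {v}" "L 3 = vec.span {w}"
    "P 1 = orth {g}" "P 2 = orth {h}"
    unfolding is_line_iff is_plane_iff by metis
  have "\<not> L 2 \<subseteq> P 1" "\<not> L 3 \<subseteq> P 1" "\<not> L 1 \<subseteq> P 2" "\<not> L 3 \<subseteq> P 2"
    using nLP by simp_all
  then show ?thesis
    using LP sum assms(2,3) unfolding S eqs span_subset_orth indep3_iff_span_sum[symmetric]
    by (intro config_indep)
qed

lemma ex_lines3_planes2:
  obtains S :: "('a::field ^ 3) set set" where "lines3_planes2 S" "finite S" "card S = 5"
proof -
  \<comment> \<open>The coordinate axes, with the plane where the last two coordinates agree and the
    plane where the first and third agree.\<close>
  define u v w g h :: "'a ^ 3" where "u = vector [1, 0, 0]" and "v = vector [0, 1, 0]"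
    and "w = vector [0, 0, 1]" and "g = vector [0, 1, -1]" and "h = vector [1, 0, -1]"
  define S where "S = {vec.span {u}, vec.span {v}, vec.span {w}, orth {g}, orth {h}}"
  have ind: "indep3 u v w"
    by (simp add: indep3_iff_orth u_def v_def w_def dot_3 vec_eq_iff forall_3)
  have nz: "u \<noteq> 0" "v \<noteq> 0" "w \<noteq> 0" "g \<noteq> 0" "h \<noteq> 0"
    by (simp_all add: u_def v_def w_def g_def h_def vec_eq_iff forall_3)
  have dots: "dot g u = 0" "dot g v \<noteq> 0" "dot g w \<noteq> 0" "dot h u \<noteq> 0" "dot h v = 0" "dot h w \<noteq> 0"
    by (simp_all add: u_def v_def w_def g_def h_def dot_3)
  have "lines3_planes2 S"
    using S_def ind nz dots by (rule lines3_planes2I)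
  moreover have "finite S"
    by (simp add: S_def)
  moreover have "card S = 5"
  proof -
    have ne: "vec.span {u} \<noteq> vec.span {v}" "vec.span {u} \<noteq> vec.span {w}" "vec.span {v} \<noteq> vec.span {w}"
      using dots span_subset_orth by metis+
    have "orth {g} \<noteq> orth {h}"
      using dots by (metis mem_orth_singleton)
    moreover have "x \<noteq> 0 \<Longrightarrow> f \<noteq> 0 \<Longrightarrow> vec.span {x} = orth {f} \<longleftrightarrow> False" for x f :: "'a ^ 3"
      using span_neq_orth by blast
    ultimately show ?thesis
      using ne nz by (simp add: S_def)
  qed
  ultimately show ?thesis
    by (rule that)
qed


section \<open>The bound of five and the final equivalence\<close>

lemma card_config_le_5:
  assumes "lines3_planes2 S \<or> planes3_lines2 S"
  shows "card S \<le> 5"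
proof -
  have "card {a, b, c, d, e} \<le> 5" for a b c d e :: "('a ^ 3) set"
    using card_insert_le_m1[of 5 "{b, c, d, e}" a] card_insert_le_m1[of 4 "{c, d, e}" b]
      card_insert_le_m1[of 3 "{d, e}" c] card_insert_le_m1[of 2 "{e}" d]
    by simp
  then show ?thesis
    using assms unfolding lines3_planes2_def planes3_lines2_def by (elim exE conjE disjE) simp_all
qed

text \<open>A larger family, finite or not, has a six-element subfamily, again independent. That
  subfamily must be one of the two configurations, which list only five subspaces.\<close>

lemma GL_indep_card_le_5:
  fixes S :: "('a::field ^ 3) set set"
  assumes S: "GL_indep S"
  shows "finite S \<and> card S \<le> 5"
proof (rule ccontr)
  assume not: "\<not> (finite S \<and> card S \<le> 5)"
  have "\<exists>T. T \<subseteq> S \<and> finite T \<and> card T = 6"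
  proof (cases "finite S")
    case True
    then have "6 \<le> card S"
      using not by linarith
    then show ?thesis
      by (meson obtain_subset_with_card_n)
  next
    case False
    then show ?thesis
      using infinite_arbitrarily_large[of S 6] by auto
  qed
  then obtain T where T: "T \<subseteq> S" "finite T" "card T = 6"
    by auto
  have "lines3_planes2 T \<or> planes3_lines2 T"
    using T act_indep_subset[OF S T(1)] by (intro GL_indep_five_cases) auto
  then show False
    using card_config_le_5 T(3) by fastforce
qed

text \<open>Complements turn the family into one with three lines and two planes; taking complements
  again returns to \<open>S\<close>.\<close>

lemma planes3_lines2_indep:
  fixes c :: "'a::field" and S :: "('a ^ 3) set set"
  assumes "planes3_lines2 S" "c \<noteq> 0" "c \<noteq> 1"
  shows "GL_indep S"
proof -
  have "is_line V \<or> is_plane V" if "V \<in> S" for V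
    using assms(1) that unfolding planes3_lines2_def by (elim exE conjE) auto
  then have "orth ` orth ` S = S"
    by (rule orth_image_orth_image)
  moreover have "GL_indep (orth ` S)"
    using lines3_planes2_orth_image lines3_planes2_indep assms by blast
  ultimately show ?thesis
    using GL_indep_orth_image by metis
qed

text \<open>\<open>card\<close> is 0 on an infinite set, which is why infinite fields form a
  separate disjunct.\<close>

lemma ex_nonzero_nonone:
  assumes "infinite (UNIV :: 'a::field set) \<or> card (UNIV :: 'a set) > 2"
  obtains c :: "'a::field" where "c \<noteq> 0" "c \<noteq> 1"
proof -
  have "UNIV \<noteq> {0, 1 :: 'a}"
  proof
    assume U: "UNIV = {0, 1 :: 'a}"
    show False
      using assms unfolding U by simp
  qed
  then show ?thesis
    using that by blast
qed

theorem theorem5p1: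
  assumes "infinite (UNIV :: 'a::field set) \<or> card (UNIV :: 'a set) > 2"
  shows "indep_number (GL :: ('a ^ 3 ^ 3) set) GL_act Sub = 5
    \<and> (\<forall>S. act_indep (GL :: ('a ^ 3 ^ 3) set) GL_act Sub S \<longrightarrow> finite S \<and> card S \<le> 5)
    \<and> (\<forall>S. S \<subseteq> (Sub :: ('a ^ 3) set set) \<and> card S = 5 \<longrightarrow>
         (act_indep (GL :: ('a ^ 3 ^ 3) set) GL_act Sub S \<longleftrightarrow> lines3_planes2 S \<or> planes3_lines2 S))"
proof (intro conjI allI impI)
  obtain c :: 'a where c: "c \<noteq> 0" "c \<noteq> 1"
    using assms by (rule ex_nonzero_nonone)
  obtain S0 :: "('a ^ 3) set set" where S0: "lines3_planes2 S0" "finite S0" "card S0 = 5"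
    by (rule ex_lines3_planes2)
  show "indep_number (GL :: ('a ^ 3 ^ 3) set) GL_act Sub = 5"
    unfolding indep_number_def
  proof (rule antisym)
    show "Sup {esize S | S. GL_indep (S :: ('a ^ 3) set set)} \<le> 5"
    proof (rule Sup_least)
      fix n assume "n \<in> {esize S | S. GL_indep (S :: ('a ^ 3) set set)}"
      then obtain S :: "('a ^ 3) set set" where "GL_indep S" "n = esize S"
        by auto
      then show "n \<le> 5"
        using GL_indep_card_le_5[of S] by (simp add: esize_def numeral_eq_enat)
    qed
    have "esize S0 = 5"
      using S0 by (simp add: esize_def numeral_eq_enat)
    moreover have "GL_indep S0"
      using S0(1) c by (rule lines3_planes2_indep)
    ultimately show "5 \<le> Sup {esize S | S. GL_indep (S :: ('a ^ 3) set set)}"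
      by (intro Sup_upper) force
  qed
  show "finite S" "card S \<le> 5" if "GL_indep S" for S :: "('a ^ 3) set set"
    using GL_indep_card_le_5[OF that] by auto
  show "GL_indep S \<longleftrightarrow> lines3_planes2 S \<or> planes3_lines2 S"
    if "S \<subseteq> Sub \<and> card S = 5" for S :: "('a ^ 3) set set"
  proof
    have "finite S"
      using that by (intro card_ge_0_finite) simp
    then show "lines3_planes2 S \<or> planes3_lines2 S" if "GL_indep S"
      using that \<open>S \<subseteq> Sub \<and> card S = 5\<close> by (intro GL_indep_five_cases) auto
    show "GL_indep S" if "lines3_planes2 S \<or> planes3_lines2 S"
      using that lines3_planes2_indep planes3_lines2_indep c by blast
  qed
qed

end
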